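(* Let $\Lambda$ be a finite-dimensional algebra over an algebraically closed field and let $d\geq2$. The subposet of hereditary cotorsion pairs in $\mathrm{K}^{[-d+1,0]}(\operatorname{proj}\Lambda)$ is a sublattice of the lattice of all cotorsion pairs in $\mathrm{K}^{[-d+1,0]}(\operatorname{proj}\Lambda)$; in particular it is a lattice.
   Context: $\mathcal{C}=\mathrm{K}^{[-d+1,0]}(\operatorname{proj}\Lambda)$ is the full subcategory of $\mathrm{K}^b(\operatorname{proj}\Lambda)$ of objects isomorphic to complexes of finitely generated projective $\Lambda$-modules concentrated in degrees $-d+1,\dots,0$; $\Sigma$ is the shift. A pair $(\mathcal{X},\mathcal{Y})$ of full subcategories of $\mathcal{C}$ is a cotorsion pair if ($\operatorname{Hom}(x,\Sigma\mathcal{Y})=0\iff x\in\mathcal{X}$) and ($\operatorname{Hom}(\mathcal{X},\Sigma y)=0\iff y\in\mathcal{Y}$), for $x,y\in\mathcal{C}$. It is hereditary if $\operatorname{Hom}(\mathcal{X},\Sigma^k\mathcal{Y})=0$ for all $k\geq2$. Cotorsion pairs are ordered by $(\mathcal{X}_1,\mathcal{Y}_1)\preceq(\mathcal{X}_2,\mathcal{Y}_2)\iff\mathcal{Y}_1\subseteq\mathcal{Y}_2\iff\mathcal{X}_1\supseteq\mathcal{X}_2$; the poset of all cotorsion pairs in $\mathcal{C}$ is a lattice. A sublattice is a subset closed under the meet and join of the ambient lattice. *)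

theory Defs
  imports "HOL-Algebra.Algebra"
begin

section \<open>Modules over a possibly noncommutative ring\<close>

text \<open>
  The locale \<^locale>\<open>module\<close> of HOL-Algebra requires a commutative ring of scalars. As there, modules
  are elements of the record type \<^type>\<open>module\<close>; its fields for multiplication and unit are
  meaningless for modules.
\<close>

locale left_module = R?: ring R + M?: abelian_group M
  for R :: "('a, 'r) ring_scheme" (structure) and M :: "('a, 'm, 's) module_scheme" (structure) +
  assumes smult_closed:
      "\<lbrakk>a \<in> carrier R; x \<in> carrier M\<rbrakk> \<Longrightarrow> a \<odot>\<^bsub>M\<^esub> x \<in> carrier M"
    and smult_l_distr:
      "\<lbrakk>a \<in> carrier R; b \<in> carrier R; x \<in> carrier M\<rbrakk> \<Longrightarrow>
        (a \<oplus>\<^bsub>R\<^esub> b) \<odot>\<^bsub>M\<^esub> x = a \<odot>\<^bsub>M\<^esub> x \<oplus>\<^bsub>M\<^esub> b \<odot>\<^bsub>M\<^esub> x"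
    and smult_r_distr:
      "\<lbrakk>a \<in> carrier R; x \<in> carrier M; y \<in> carrier M\<rbrakk> \<Longrightarrow>
        a \<odot>\<^bsub>M\<^esub> (x \<oplus>\<^bsub>M\<^esub> y) = a \<odot>\<^bsub>M\<^esub> x \<oplus>\<^bsub>M\<^esub> a \<odot>\<^bsub>M\<^esub> y"
    and smult_assoc1:
      "\<lbrakk>a \<in> carrier R; b \<in> carrier R; x \<in> carrier M\<rbrakk> \<Longrightarrow>
        (a \<otimes>\<^bsub>R\<^esub> b) \<odot>\<^bsub>M\<^esub> x = a \<odot>\<^bsub>M\<^esub> (b \<odot>\<^bsub>M\<^esub> x)"
    and smult_one:
      "x \<in> carrier M \<Longrightarrow> \<one>\<^bsub>R\<^esub> \<odot>\<^bsub>M\<^esub> x = x"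

definition mod_hom ::
  "('a, 'r) ring_scheme \<Rightarrow> ('a, 'm, 's) module_scheme \<Rightarrow> ('a, 'n, 't) module_scheme \<Rightarrow> ('m \<Rightarrow> 'n) set"
  where "mod_hom R M N = {f \<in> carrier M \<rightarrow> carrier N.
    (\<forall>x\<in>carrier M. \<forall>y\<in>carrier M. f (x \<oplus>\<^bsub>M\<^esub> y) = f x \<oplus>\<^bsub>N\<^esub> f y) \<and>
    (\<forall>a\<in>carrier R. \<forall>x\<in>carrier M. f (a \<odot>\<^bsub>M\<^esub> x) = a \<odot>\<^bsub>N\<^esub> f x)}"

definition fin_gen :: "('a, 'r) ring_scheme \<Rightarrow> ('a, 'm, 's) module_scheme \<Rightarrow> bool" where
  "fin_gen R M \<longleftrightarrow> (\<exists>S. finite S \<and> S \<subseteq> carrier M \<and>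
     (\<forall>x\<in>carrier M. \<exists>c \<in> S \<rightarrow> carrier R. x = (\<Oplus>\<^bsub>M\<^esub>s\<in>S. c s \<odot>\<^bsub>M\<^esub> s)))"

text \<open>
  The lifting property. The test modules \<open>M\<close>, \<open>N\<close> live on the same type as \<open>P\<close>; see the remark
  below on why this is no restriction for the type used here.
\<close>

definition projective :: "('a, 'r) ring_scheme \<Rightarrow> ('a, 'm) module \<Rightarrow> bool" where
  "projective R P \<longleftrightarrow> left_module R P \<and>
     (\<forall>(M :: ('a, 'm) module) (N :: ('a, 'm) module). left_module R M \<longrightarrow> left_module R N \<longrightarrow>
       (\<forall>g \<in> mod_hom R M N. \<forall>f \<in> mod_hom R P N. g ` carrier M = carrier N \<longrightarrow>
         (\<exists>h \<in> mod_hom R P M. \<forall>x\<in>carrier P. g (h x) = f x)))"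

definition fin_dim_algebra :: "('k, 'r) ring_scheme \<Rightarrow> ('k, 'a, 's) module_scheme \<Rightarrow> bool" where
  "fin_dim_algebra K A \<longleftrightarrow> field K \<and> module K A \<and> ring A \<and>
     (\<forall>a\<in>carrier K. \<forall>x\<in>carrier A. \<forall>y\<in>carrier A.
        (a \<odot>\<^bsub>A\<^esub> x) \<otimes>\<^bsub>A\<^esub> y = a \<odot>\<^bsub>A\<^esub> (x \<otimes>\<^bsub>A\<^esub> y) \<and>
        x \<otimes>\<^bsub>A\<^esub> (a \<odot>\<^bsub>A\<^esub> y) = a \<odot>\<^bsub>A\<^esub> (x \<otimes>\<^bsub>A\<^esub> y)) \<and>
     fin_gen K A"

text \<open>
  Finitely generated projective left modules, as a set of objects. Their elements are taken from the
  type \<open>nat \<Rightarrow> 'a\<close>, where \<open>'a\<close> is the type of the elements of \<open>R\<close>. Up to isomorphism this gives all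
  of them: a free module of rank \<open>n\<close> is realised on the functions vanishing at all arguments
  \<open>\<ge> n\<close>, and a quotient of it on a set of representatives, so every finitely generated module has
  an isomorphic copy on this type. For the same reason, the lifting property for test modules on this
  type already makes a finitely generated module a direct summand of a free module of finite rank.
\<close>

type_synonym 'a lmod = "('a, nat \<Rightarrow> 'a) module"

definition proj :: "('a, 'r) ring_scheme \<Rightarrow> 'a lmod set" where
  "proj R = {P. projective R P \<and> fin_gen R P}"


section \<open>The homotopy category of bounded complexes\<close>

text \<open>Complexes are cochain complexes; \<open>dif C i\<close> maps degree \<open>i\<close> to degree \<open>i + 1\<close>.\<close>

record 'a cplx =
  Ob :: "int \<Rightarrow> 'a lmod"
  dif :: "int \<Rightarrow> (nat \<Rightarrow> 'a) \<Rightarrow> (nat \<Rightarrow> 'a)"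

definition Kb_proj :: "('a, 'r) ring_scheme \<Rightarrow> 'a cplx set" where
  "Kb_proj R = {C.
     (\<forall>i. Ob C i \<in> proj R) \<and>
     (\<forall>i. dif C i \<in> mod_hom R (Ob C i) (Ob C (i + 1))) \<and>
     (\<forall>i. \<forall>x\<in>carrier (Ob C i). dif C (i + 1) (dif C i x) = \<zero>\<^bsub>Ob C (i + 2)\<^esub>) \<and>
     finite {i. carrier (Ob C i) \<noteq> {\<zero>\<^bsub>Ob C i\<^esub>}}}"

definition chain_maps ::
  "('a, 'r) ring_scheme \<Rightarrow> 'a cplx \<Rightarrow> 'a cplx \<Rightarrow> (int \<Rightarrow> (nat \<Rightarrow> 'a) \<Rightarrow> (nat \<Rightarrow> 'a)) set" where
  "chain_maps R C D = {f.
     (\<forall>i. f i \<in> mod_hom R (Ob C i) (Ob D i)) \<and>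
     (\<forall>i. \<forall>x\<in>carrier (Ob C i). f (i + 1) (dif C i x) = dif D i (f i x))}"

definition homotopy ::
  "('a, 'r) ring_scheme \<Rightarrow> 'a cplx \<Rightarrow> 'a cplx \<Rightarrow>
     ((int \<Rightarrow> (nat \<Rightarrow> 'a) \<Rightarrow> (nat \<Rightarrow> 'a)) \<times> (int \<Rightarrow> (nat \<Rightarrow> 'a) \<Rightarrow> (nat \<Rightarrow> 'a))) set" where
  "homotopy R C D = {(f, g). f \<in> chain_maps R C D \<and> g \<in> chain_maps R C D \<and>
     (\<exists>s. (\<forall>i. s i \<in> mod_hom R (Ob C i) (Ob D (i - 1))) \<and>
          (\<forall>i. \<forall>x\<in>carrier (Ob C i).
             f i x = g i x \<oplus>\<^bsub>Ob D i\<^esub> (dif D (i - 1) (s i x) \<oplus>\<^bsub>Ob D i\<^esub> s (i + 1) (dif C i x))))}"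

text \<open>
  Maps are not required to be extensional: the values of a chain map outside the carriers are
  irrelevant to \<^const>\<open>homotopy\<close>, hence disappear in the quotient.
\<close>

definition KHom ::
  "('a, 'r) ring_scheme \<Rightarrow> 'a cplx \<Rightarrow> 'a cplx \<Rightarrow> (int \<Rightarrow> (nat \<Rightarrow> 'a) \<Rightarrow> (nat \<Rightarrow> 'a)) set set" where
  "KHom R C D = chain_maps R C D // homotopy R C D"

definition KHom_vanishes :: "('a, 'r) ring_scheme \<Rightarrow> 'a cplx \<Rightarrow> 'a cplx \<Rightarrow> bool" where
  "KHom_vanishes R C D \<longleftrightarrow> KHom R C D = {homotopy R C D `` {\<lambda>i x. \<zero>\<^bsub>Ob D i\<^esub>}}"

definition K_iso :: "('a, 'r) ring_scheme \<Rightarrow> 'a cplx \<Rightarrow> 'a cplx \<Rightarrow> bool" where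
  "K_iso R C D \<longleftrightarrow> (\<exists>f \<in> chain_maps R C D. \<exists>g \<in> chain_maps R D C.
     ((\<lambda>i. g i \<circ> f i), (\<lambda>i. id)) \<in> homotopy R C C \<and>
     ((\<lambda>i. f i \<circ> g i), (\<lambda>i. id)) \<in> homotopy R D D)"

definition shift :: "'a cplx \<Rightarrow> 'a cplx" where
  "shift C = \<lparr>Ob = (\<lambda>i. Ob C (i + 1)), dif = (\<lambda>i x. \<ominus>\<^bsub>Ob C (i + 2)\<^esub> dif C (i + 1) x)\<rparr>"

text \<open>The full subcategory of complexes isomorphic to one concentrated in degrees \<open>-d+1, \<dots>, 0\<close>.\<close>

definition K_trunc :: "('a, 'r) ring_scheme \<Rightarrow> nat \<Rightarrow> 'a cplx set" where
  "K_trunc R d = {C \<in> Kb_proj R. \<exists>D \<in> Kb_proj R.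
     (\<forall>i. i \<notin> {- int d + 1..0} \<longrightarrow> carrier (Ob D i) = {\<zero>\<^bsub>Ob D i\<^esub>}) \<and> K_iso R C D}"


section \<open>Cotorsion pairs\<close>

text \<open>Full subcategories are represented by their sets of objects.\<close>

definition cotorsion_pair ::
  "('a, 'r) ring_scheme \<Rightarrow> nat \<Rightarrow> 'a cplx set \<times> 'a cplx set \<Rightarrow> bool" where
  "cotorsion_pair R d = (\<lambda>(\<C>, \<D>). \<C> \<subseteq> K_trunc R d \<and> \<D> \<subseteq> K_trunc R d \<and>
     (\<forall>x \<in> K_trunc R d. (\<forall>y\<in>\<D>. KHom_vanishes R x (shift y)) \<longleftrightarrow> x \<in> \<C>) \<and>
     (\<forall>y \<in> K_trunc R d. (\<forall>x\<in>\<C>. KHom_vanishes R x (shift y)) \<longleftrightarrow> y \<in> \<D>))"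

definition hereditary ::
  "('a, 'r) ring_scheme \<Rightarrow> 'a cplx set \<times> 'a cplx set \<Rightarrow> bool" where
  "hereditary R = (\<lambda>(\<C>, \<D>).
     \<forall>k\<ge>2. \<forall>x\<in>\<C>. \<forall>y\<in>\<D>. KHom_vanishes R x ((shift ^^ k) y))"

definition cotors :: "('a, 'r) ring_scheme \<Rightarrow> nat \<Rightarrow> ('a cplx set \<times> 'a cplx set) gorder" where
  "cotors R d = \<lparr>carrier = {p. cotorsion_pair R d p}, eq = (=), le = (\<lambda>p q. snd p \<subseteq> snd q)\<rparr>"

lemma cotors_le_iff:
  assumes "p \<in> carrier (cotors R d)" and "q \<in> carrier (cotors R d)"
  shows "p \<sqsubseteq>\<^bsub>cotors R d\<^esub> q \<longleftrightarrow> fst q \<subseteq> fst p"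
proof -
  obtain X1 Y1 X2 Y2 where pq: "p = (X1, Y1)" "q = (X2, Y2)"
    by (cases p, cases q)
  have p: "cotorsion_pair R d (X1, Y1)" and q: "cotorsion_pair R d (X2, Y2)"
    using assms by (simp_all add: cotors_def pq)
  have "Y1 \<subseteq> Y2 \<longleftrightarrow> X2 \<subseteq> X1"
  proof
    assume "Y1 \<subseteq> Y2"
    then show "X2 \<subseteq> X1"
      using p q unfolding cotorsion_pair_def prod.case by (meson subset_iff)
  next
    assume "X2 \<subseteq> X1"
    then show "Y1 \<subseteq> Y2"
      using p q unfolding cotorsion_pair_def prod.case by (meson subset_iff)
  qed
  then show ?thesis
    by (simp add: cotors_def pq)
qed

definition hereditary_cotors :: "('a, 'r) ring_scheme \<Rightarrow> nat \<Rightarrow> ('a cplx set \<times> 'a cplx set) set" where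
  "hereditary_cotors R d = {p. cotorsion_pair R d p \<and> hereditary R p}"

definition sublattice :: "('a, 'b) gorder_scheme \<Rightarrow> 'a set \<Rightarrow> bool" where
  "sublattice L S \<longleftrightarrow> S \<subseteq> carrier L \<and> (\<forall>x\<in>S. \<forall>y\<in>S. x \<squnion>\<^bsub>L\<^esub> y \<in> S \<and> x \<sqinter>\<^bsub>L\<^esub> y \<in> S)"

end

theory Submission
  imports Defs
begin

text \<open>
  Cotorsion pairs are the closed pairs of the Galois connection given by vanishing of
  \<open>Hom(x, \<Sigma>y)\<close>, so joins are computed by intersecting first components and meets by
  intersecting second components. Brutal truncation gives syzygies \<open>\<Omega>x\<close> and cosyzygies \<open>\<mho>y\<close> in the
  category, such that for \<open>k \<ge> 1\<close> vanishing of \<open>Hom(x, \<Sigma>\<^sup>k\<^sup>+\<^sup>1y)\<close>, of \<open>Hom(\<Omega>x, \<Sigma>\<^sup>ky)\<close> and of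
  \<open>Hom(x, \<Sigma>\<^sup>k\<mho>y)\<close> are equivalent. Hence a cotorsion pair is hereditary iff its first component is
  closed under syzygies, and iff its second component is closed under cosyzygies. Both closure
  properties pass to intersections.
\<close>

section \<open>Homomorphisms of modules\<close>

text \<open>The equivalences come from degree bounds, checked on explicit chain maps and homotopies,
  without triangles or long exact sequences. If \<open>y\<close> is concentrated in degrees
  \<open>- int d + 1..0\<close> and \<open>k \<ge> 1\<close>, then \<open>(shift ^^ Suc k) y\<close>
  is zero in all degrees from -1 on, so maps into it and their homotopies see of the source only the
  degrees up to -1. Dually, a concentrated source is zero in degrees up to \<open>- int d\<close>
  and sees of the target only the degrees from there on. For \<open>k = 0\<close> the bound is one
  degree short, because a homotopy also uses the degree next to the support. Hence vanishing of
  Hom(x, \<Sigma>y) has to come from the cotorsion pair itself and starts the induction. Brutal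
  truncation is not invariant under homotopy equivalence, and objects of \<open>K_trunc\<close> are
  only isomorphic to concentrated ones. Syzygies are therefore formed on concentrated
  representatives, and invariance of vanishing under isomorphism carries the result back. Two
  criteria are needed because a join is controlled only in its first component and a meet only in
  its second; the other component is just an orthogonal class.\<close>

lemma (in left_module) smult_zero:
  assumes "a \<in> carrier R"
  shows "a \<odot>\<^bsub>M\<^esub> \<zero>\<^bsub>M\<^esub> = \<zero>\<^bsub>M\<^esub>"
proof -
  have "a \<odot>\<^bsub>M\<^esub> \<zero>\<^bsub>M\<^esub> \<oplus>\<^bsub>M\<^esub> a \<odot>\<^bsub>M\<^esub> \<zero>\<^bsub>M\<^esub> = a \<odot>\<^bsub>M\<^esub> \<zero>\<^bsub>M\<^esub>"
    using smult_r_distr[OF assms M.zero_closed M.zero_closed] by simp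
  then show ?thesis
    using smult_closed[OF assms M.zero_closed] by simp
qed

lemma (in left_module) smult_minus:
  assumes "a \<in> carrier R" "x \<in> carrier M"
  shows "a \<odot>\<^bsub>M\<^esub> (\<ominus>\<^bsub>M\<^esub> x) = \<ominus>\<^bsub>M\<^esub> (a \<odot>\<^bsub>M\<^esub> x)"
proof (rule M.minus_equality[symmetric])
  show "a \<odot>\<^bsub>M\<^esub> (\<ominus>\<^bsub>M\<^esub> x) \<oplus>\<^bsub>M\<^esub> a \<odot>\<^bsub>M\<^esub> x = \<zero>\<^bsub>M\<^esub>"
    using assms by (metis M.a_inv_closed M.l_neg smult_r_distr smult_zero)
qed (use assms in \<open>auto simp: smult_closed\<close>)

lemma left_module_abelian_group: "left_module R M \<Longrightarrow> abelian_group M"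
  by (simp add: left_module_def)

lemma mod_hom_closed: "f \<in> mod_hom R M N \<Longrightarrow> x \<in> carrier M \<Longrightarrow> f x \<in> carrier N"
  by (auto simp: mod_hom_def)

lemma mod_hom_add:
  "f \<in> mod_hom R M N \<Longrightarrow> x \<in> carrier M \<Longrightarrow> y \<in> carrier M \<Longrightarrow> f (x \<oplus>\<^bsub>M\<^esub> y) = f x \<oplus>\<^bsub>N\<^esub> f y"
  by (auto simp: mod_hom_def)

lemma mod_hom_zero:
  assumes f: "f \<in> mod_hom R M N" and "abelian_group M" "abelian_group N"
  shows "f \<zero>\<^bsub>M\<^esub> = \<zero>\<^bsub>N\<^esub>"
proof -
  interpret M: abelian_group M by fact
  interpret N: abelian_group N by fact
  have "f \<zero>\<^bsub>M\<^esub> \<oplus>\<^bsub>N\<^esub> f \<zero>\<^bsub>M\<^esub> = f \<zero>\<^bsub>M\<^esub>"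
    by (metis M.l_zero M.zero_closed mod_hom_add[OF f])
  then show ?thesis
    using mod_hom_closed[OF f M.zero_closed] by (metis N.add.r_cancel_one')
qed

lemma mod_hom_minus:
  assumes f: "f \<in> mod_hom R M N" and "abelian_group M" "abelian_group N" and x: "x \<in> carrier M"
  shows "f (\<ominus>\<^bsub>M\<^esub> x) = \<ominus>\<^bsub>N\<^esub> f x"
proof -
  interpret M: abelian_group M by fact
  interpret N: abelian_group N by fact
  have "f (\<ominus>\<^bsub>M\<^esub> x) \<oplus>\<^bsub>N\<^esub> f x = \<zero>\<^bsub>N\<^esub>"
    using x mod_hom_add[OF f] mod_hom_zero[OF f] assms by (metis M.a_inv_closed M.l_neg)
  then show ?thesis
    using x mod_hom_closed[OF f] by (metis M.a_inv_closed N.minus_equality)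
qed

lemma zero_mod_hom:
  assumes "left_module R N" shows "(\<lambda>x. \<zero>\<^bsub>N\<^esub>) \<in> mod_hom R M N"
proof -
  interpret left_module R N by fact
  show ?thesis by (simp add: mod_hom_def smult_zero)
qed

lemma id_mod_hom: "id \<in> mod_hom R M M"
  by (simp add: mod_hom_def)

lemma comp_mod_hom: "f \<in> mod_hom R M N \<Longrightarrow> g \<in> mod_hom R N P \<Longrightarrow> (\<lambda>x. g (f x)) \<in> mod_hom R M P"
  by (simp add: mod_hom_def Pi_iff)

lemma add_mod_hom:
  assumes "left_module R N" "f \<in> mod_hom R M N" "g \<in> mod_hom R M N"
  shows "(\<lambda>x. f x \<oplus>\<^bsub>N\<^esub> g x) \<in> mod_hom R M N"
proof -
  interpret left_module R N by fact
  show ?thesis using assms(2,3) by (simp add: mod_hom_def Pi_iff smult_r_distr M.a_ac)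
qed

lemma minus_mod_hom:
  assumes "left_module R N" "f \<in> mod_hom R M N"
  shows "(\<lambda>x. \<ominus>\<^bsub>N\<^esub> f x) \<in> mod_hom R M N"
proof -
  interpret left_module R N by fact
  show ?thesis using assms(2) by (simp add: mod_hom_def Pi_iff smult_minus M.minus_add)
qed

section \<open>Homotopies\<close>

text \<open>Iterated shifts of objects of \<open>K_trunc\<close> leave that category. This class is
  wide enough to be visibly closed under \<open>shift\<close>, and it carries all the structure on
  which homotopies are computed.\<close>

definition precomplex :: "('a, 'r) ring_scheme \<Rightarrow> 'a cplx \<Rightarrow> bool" where
  "precomplex R C \<longleftrightarrow> (\<forall>i. left_module R (Ob C i)) \<and> (\<forall>i. dif C i \<in> mod_hom R (Ob C i) (Ob C (i + 1)))"

text \<open>The variant at \<open>i - 1\<close> is stated separately because homotopies use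
  \<open>dif D (i - 1)\<close>, whose target \<open>Ob D (i - 1 + 1)\<close> is not literally
  \<open>Ob D i\<close>.\<close>

lemma precomplexD:
  assumes "precomplex R C"
  shows precomplex_left_module: "left_module R (Ob C i)"
    and precomplex_abelian_group: "abelian_group (Ob C i)"
    and precomplex_dif: "dif C i \<in> mod_hom R (Ob C i) (Ob C (i + 1))"
    and precomplex_dif_pred: "dif C (i - 1) \<in> mod_hom R (Ob C (i - 1)) (Ob C i)"
  using assms unfolding precomplex_def
  by (auto intro: left_module_abelian_group) (metis diff_add_cancel)

lemma Kb_proj_precomplex: "C \<in> Kb_proj R \<Longrightarrow> precomplex R C"
  by (auto simp: Kb_proj_def precomplex_def proj_def projective_def)

lemma chain_maps_mod_hom: "f \<in> chain_maps R C D \<Longrightarrow> f i \<in> mod_hom R (Ob C i) (Ob D i)"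
  by (simp add: chain_maps_def)

lemma chain_maps_dif:
  assumes "f \<in> chain_maps R C D" "x \<in> carrier (Ob C i)"
  shows "f (i + 1) (dif C i x) = dif D i (f i x)"
  using assms by (simp add: chain_maps_def)

lemma homotopyI:
  assumes "f \<in> chain_maps R C D" "g \<in> chain_maps R C D"
    and "\<And>i. s i \<in> mod_hom R (Ob C i) (Ob D (i - 1))"
    and "\<And>i x. x \<in> carrier (Ob C i) \<Longrightarrow>
      f i x = g i x \<oplus>\<^bsub>Ob D i\<^esub> (dif D (i - 1) (s i x) \<oplus>\<^bsub>Ob D i\<^esub> s (i + 1) (dif C i x))"
  shows "(f, g) \<in> homotopy R C D"
  using assms unfolding homotopy_def by blast

lemma homotopyE:
  assumes "(f, g) \<in> homotopy R C D"
  obtains s where "f \<in> chain_maps R C D" "g \<in> chain_maps R C D"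
    and "\<And>i. s i \<in> mod_hom R (Ob C i) (Ob D (i - 1))"
    and "\<And>i x. x \<in> carrier (Ob C i) \<Longrightarrow>
      f i x = g i x \<oplus>\<^bsub>Ob D i\<^esub> (dif D (i - 1) (s i x) \<oplus>\<^bsub>Ob D i\<^esub> s (i + 1) (dif C i x))"
  using assms unfolding homotopy_def by blast

lemma homotopy_terms_closed:
  assumes C: "precomplex R C" and D: "precomplex R D"
    and s: "\<And>i. s i \<in> mod_hom R (Ob C i) (Ob D (i - 1))" and x: "x \<in> carrier (Ob C i)"
  shows "dif D (i - 1) (s i x) \<in> carrier (Ob D i)" and "s (i + 1) (dif C i x) \<in> carrier (Ob D i)"
  using mod_hom_closed[OF precomplex_dif_pred[OF D] mod_hom_closed[OF s x]]
    mod_hom_closed[OF s[of "i + 1"] mod_hom_closed[OF precomplex_dif[OF C] x]]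
  by simp_all

section \<open>Homotopy as an equivalence relation on chain maps\<close>

lemma homotopy_refl:
  assumes C: "precomplex R C" and D: "precomplex R D"
    and fg: "f \<in> chain_maps R C D" "g \<in> chain_maps R C D" "\<And>i x. x \<in> carrier (Ob C i) \<Longrightarrow> f i x = g i x"
  shows "(f, g) \<in> homotopy R C D"
proof (rule homotopyI[where s = "\<lambda>i x. \<zero>\<^bsub>Ob D (i - 1)\<^esub>"])
  fix i x assume x: "x \<in> carrier (Ob C i)"
  interpret abelian_group "Ob D i" by (rule precomplex_abelian_group[OF D])
  have "g i x \<in> carrier (Ob D i)"
    using x fg chain_maps_mod_hom mod_hom_closed by metis
  moreover have "dif D (i - 1) \<zero>\<^bsub>Ob D (i - 1)\<^esub> = \<zero>\<^bsub>Ob D i\<^esub>"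
    using precomplex_dif_pred[OF D] precomplex_abelian_group[OF D] precomplex_abelian_group[OF D]
    by (rule mod_hom_zero)
  ultimately show "f i x = g i x \<oplus>\<^bsub>Ob D i\<^esub>
      (dif D (i - 1) \<zero>\<^bsub>Ob D (i - 1)\<^esub> \<oplus>\<^bsub>Ob D i\<^esub> \<zero>\<^bsub>Ob D (i + 1 - 1)\<^esub>)"
    using fg(3)[OF x] by simp
qed (use fg in \<open>auto intro!: zero_mod_hom precomplex_left_module[OF D]\<close>)

lemma homotopy_sym:
  assumes C: "precomplex R C" and D: "precomplex R D" and "(f, g) \<in> homotopy R C D"
  shows "(g, f) \<in> homotopy R C D"
proof -
  obtain s where f: "f \<in> chain_maps R C D" and g: "g \<in> chain_maps R C D"
    and s: "\<And>i. s i \<in> mod_hom R (Ob C i) (Ob D (i - 1))"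
    and eq: "\<And>i x. x \<in> carrier (Ob C i) \<Longrightarrow>
      f i x = g i x \<oplus>\<^bsub>Ob D i\<^esub> (dif D (i - 1) (s i x) \<oplus>\<^bsub>Ob D i\<^esub> s (i + 1) (dif C i x))"
    using assms(3) by (rule homotopyE) blast
  show ?thesis
  proof (rule homotopyI[OF g f, where s = "\<lambda>i x. \<ominus>\<^bsub>Ob D (i - 1)\<^esub> s i x"])
    fix i x assume x: "x \<in> carrier (Ob C i)"
    interpret abelian_group "Ob D i" by (rule precomplex_abelian_group[OF D])
    have 1: "s i x \<in> carrier (Ob D (i - 1))"
      using s x mod_hom_closed by metis
    note 2 = homotopy_terms_closed[OF C D s x]
    have 3: "g i x \<in> carrier (Ob D i)"
      using mod_hom_closed[OF chain_maps_mod_hom[OF g] x] .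
    have 4: "dif D (i - 1) (\<ominus>\<^bsub>Ob D (i - 1)\<^esub> s i x) = \<ominus>\<^bsub>Ob D i\<^esub> dif D (i - 1) (s i x)"
      by (rule mod_hom_minus[OF precomplex_dif_pred[OF D] _ _ 1]) (rule precomplex_abelian_group[OF D])+
    show "g i x = f i x \<oplus>\<^bsub>Ob D i\<^esub> (dif D (i - 1) (\<ominus>\<^bsub>Ob D (i - 1)\<^esub> s i x)
        \<oplus>\<^bsub>Ob D i\<^esub> \<ominus>\<^bsub>Ob D (i + 1 - 1)\<^esub> s (i + 1) (dif C i x))"
      using 2 3 by (simp add: 4 eq[OF x] a_assoc minus_add[symmetric] r_neg)
  qed (use s in \<open>auto intro!: minus_mod_hom precomplex_left_module[OF D]\<close>)
qed

lemma homotopy_trans: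
  assumes C: "precomplex R C" and D: "precomplex R D"
    and fg: "(f, g) \<in> homotopy R C D" and gh: "(g, h) \<in> homotopy R C D"
  shows "(f, h) \<in> homotopy R C D"
proof -
  obtain s where f: "f \<in> chain_maps R C D"
    and s: "\<And>i. s i \<in> mod_hom R (Ob C i) (Ob D (i - 1))"
    and eq: "\<And>i x. x \<in> carrier (Ob C i) \<Longrightarrow>
      f i x = g i x \<oplus>\<^bsub>Ob D i\<^esub> (dif D (i - 1) (s i x) \<oplus>\<^bsub>Ob D i\<^esub> s (i + 1) (dif C i x))"
    using fg by (rule homotopyE) blast
  obtain t where h: "h \<in> chain_maps R C D"
    and t: "\<And>i. t i \<in> mod_hom R (Ob C i) (Ob D (i - 1))"
    and eq': "\<And>i x. x \<in> carrier (Ob C i) \<Longrightarrow>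
      g i x = h i x \<oplus>\<^bsub>Ob D i\<^esub> (dif D (i - 1) (t i x) \<oplus>\<^bsub>Ob D i\<^esub> t (i + 1) (dif C i x))"
    using gh by (rule homotopyE) blast
  show ?thesis
  proof (rule homotopyI[OF f h, where s = "\<lambda>i x. s i x \<oplus>\<^bsub>Ob D (i - 1)\<^esub> t i x"])
    fix i x assume x: "x \<in> carrier (Ob C i)"
    interpret abelian_group "Ob D i" by (rule precomplex_abelian_group[OF D])
    have 1: "s i x \<in> carrier (Ob D (i - 1))" "t i x \<in> carrier (Ob D (i - 1))"
      using s t x mod_hom_closed by metis+
    note 2 = homotopy_terms_closed[OF C D s x] homotopy_terms_closed[OF C D t x]
    have 3: "h i x \<in> carrier (Ob D i)"
      using mod_hom_closed[OF chain_maps_mod_hom[OF h] x] .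
    show "f i x = h i x \<oplus>\<^bsub>Ob D i\<^esub> (dif D (i - 1) (s i x \<oplus>\<^bsub>Ob D (i - 1)\<^esub> t i x)
        \<oplus>\<^bsub>Ob D i\<^esub> (s (i + 1) (dif C i x) \<oplus>\<^bsub>Ob D (i + 1 - 1)\<^esub> t (i + 1) (dif C i x)))"
      using 2 3 by (simp add: mod_hom_add[OF precomplex_dif_pred[OF D] 1] eq[OF x] eq'[OF x] a_ac)
  qed (use s t in \<open>auto intro!: add_mod_hom precomplex_left_module[OF D]\<close>)
qed

section \<open>Composition of chain maps and its compatibility with homotopy\<close>

lemma zero_chain_map:
  assumes C: "precomplex R C" and D: "precomplex R D"
  shows "(\<lambda>i x. \<zero>\<^bsub>Ob D i\<^esub>) \<in> chain_maps R C D"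
  unfolding chain_maps_def
  using mod_hom_zero[OF precomplex_dif[OF D] precomplex_abelian_group[OF D] precomplex_abelian_group[OF D]]
  by (auto intro!: zero_mod_hom precomplex_left_module[OF D])

lemma id_chain_map: "(\<lambda>i. id) \<in> chain_maps R C C"
  by (simp add: chain_maps_def id_mod_hom)

lemma comp_chain_map:
  assumes "f \<in> chain_maps R C D" "g \<in> chain_maps R D E"
  shows "(\<lambda>i. g i \<circ> f i) \<in> chain_maps R C E"
  unfolding chain_maps_def
proof (intro CollectI conjI allI ballI)
  fix i
  show "g i \<circ> f i \<in> mod_hom R (Ob C i) (Ob E i)"
    unfolding comp_def
    by (rule comp_mod_hom[OF chain_maps_mod_hom chain_maps_mod_hom]) (rule assms)+
  fix x assume "x \<in> carrier (Ob C i)"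
  then show "(g (i + 1) \<circ> f (i + 1)) (dif C i x) = dif E i ((g i \<circ> f i) x)"
    using assms mod_hom_closed[OF chain_maps_mod_hom[OF assms(1)]] by (simp add: chain_maps_def)
qed

text \<open>Since \<open>h\<close> commutes with the differentials, it carries a homotopy
  \<open>s\<close> to the homotopy \<open>h s\<close>. For precomposition the same argument gives
  \<open>s h\<close>.\<close>

lemma homotopy_comp_left:
  assumes C: "precomplex R C" and D: "precomplex R D" and E: "precomplex R E"
    and fg: "(f, g) \<in> homotopy R C D" and h: "h \<in> chain_maps R D E"
  shows "(\<lambda>i. h i \<circ> f i, \<lambda>i. h i \<circ> g i) \<in> homotopy R C E"
proof -
  obtain s where f: "f \<in> chain_maps R C D" and g: "g \<in> chain_maps R C D"
    and s: "\<And>i. s i \<in> mod_hom R (Ob C i) (Ob D (i - 1))"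
    and eq: "\<And>i x. x \<in> carrier (Ob C i) \<Longrightarrow>
      f i x = g i x \<oplus>\<^bsub>Ob D i\<^esub> (dif D (i - 1) (s i x) \<oplus>\<^bsub>Ob D i\<^esub> s (i + 1) (dif C i x))"
    using fg by (rule homotopyE) blast
  have hom: "h i \<in> mod_hom R (Ob D i) (Ob E i)" for i using h by (rule chain_maps_mod_hom)
  show ?thesis
  proof (rule homotopyI[where s = "\<lambda>i x. h (i - 1) (s i x)"])
    fix i x assume x: "x \<in> carrier (Ob C i)"
    interpret abelian_group "Ob D i" by (rule precomplex_abelian_group[OF D])
    have 1: "s i x \<in> carrier (Ob D (i - 1))"
      using s x mod_hom_closed by metis
    note 2 = homotopy_terms_closed[OF C D s x]
    have 3: "g i x \<in> carrier (Ob D i)"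
      using mod_hom_closed[OF chain_maps_mod_hom[OF g] x] .
    have 4: "h i (dif D (i - 1) (s i x)) = dif E (i - 1) (h (i - 1) (s i x))"
      using chain_maps_dif[OF h 1] by simp
    show "(h i \<circ> f i) x = (h i \<circ> g i) x \<oplus>\<^bsub>Ob E i\<^esub> (dif E (i - 1) (h (i - 1) (s i x))
        \<oplus>\<^bsub>Ob E i\<^esub> h (i + 1 - 1) (s (i + 1) (dif C i x)))"
      using 2 3 by (simp add: eq[OF x] mod_hom_add[OF hom[of i]] 4[symmetric])
  qed (rule comp_chain_map[OF f h] comp_chain_map[OF g h] comp_mod_hom[OF s hom])+
qed

lemma homotopy_comp_right:
  assumes C: "precomplex R C"
    and fg: "(f, g) \<in> homotopy R D E" and h: "h \<in> chain_maps R C D"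
  shows "(\<lambda>i. f i \<circ> h i, \<lambda>i. g i \<circ> h i) \<in> homotopy R C E"
proof -
  obtain s where f: "f \<in> chain_maps R D E" and g: "g \<in> chain_maps R D E"
    and s: "\<And>i. s i \<in> mod_hom R (Ob D i) (Ob E (i - 1))"
    and eq: "\<And>i x. x \<in> carrier (Ob D i) \<Longrightarrow>
      f i x = g i x \<oplus>\<^bsub>Ob E i\<^esub> (dif E (i - 1) (s i x) \<oplus>\<^bsub>Ob E i\<^esub> s (i + 1) (dif D i x))"
    using fg by (rule homotopyE) blast
  have hom: "h i \<in> mod_hom R (Ob C i) (Ob D i)" for i using h by (rule chain_maps_mod_hom)
  show ?thesis
  proof (rule homotopyI[where s = "\<lambda>i x. s i (h i x)"])
    fix i x assume x: "x \<in> carrier (Ob C i)"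
    have "h (i + 1) (dif C i x) = dif D i (h i x)"
      using h x by (auto simp: chain_maps_def)
    then show "(f i \<circ> h i) x = (g i \<circ> h i) x \<oplus>\<^bsub>Ob E i\<^esub> (dif E (i - 1) (s i (h i x))
        \<oplus>\<^bsub>Ob E i\<^esub> s (i + 1) (h (i + 1) (dif C i x)))"
      by (simp only: comp_apply eq[OF mod_hom_closed[OF hom x]])
  qed (rule comp_chain_map[OF h f] comp_chain_map[OF h g] comp_mod_hom[OF hom s])+
qed

section \<open>Vanishing of Hom and its invariance under isomorphism\<close>

lemma equiv_homotopy:
  assumes "precomplex R C" "precomplex R D"
  shows "equiv (chain_maps R C D) (homotopy R C D)"
proof (rule equivI)
  show "homotopy R C D \<subseteq> chain_maps R C D \<times> chain_maps R C D"
    unfolding homotopy_def by blast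
  show "refl_on (chain_maps R C D) (homotopy R C D)"
    by (rule refl_onI) (rule homotopy_refl[OF assms], assumption, assumption, rule refl)
  show "sym (homotopy R C D)"
    by (rule symI) (rule homotopy_sym[OF assms])
  show "trans (homotopy R C D)"
    by (rule transI) (rule homotopy_trans[OF assms])
qed

text \<open>As homotopy is an equivalence relation, having the class of zero as its only class means
  that every chain map is null-homotopic. All later arguments use this form.\<close>

lemma KHom_vanishes_iff:
  assumes "precomplex R C" "precomplex R D"
  shows "KHom_vanishes R C D \<longleftrightarrow> (\<forall>f \<in> chain_maps R C D. (f, \<lambda>i x. \<zero>\<^bsub>Ob D i\<^esub>) \<in> homotopy R C D)"
    (is "_ \<longleftrightarrow> (\<forall>f \<in> ?F. (f, ?z) \<in> ?H)")
proof -
  have z: "?z \<in> ?F" using assms by (rule zero_chain_map)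
  have eq: "equiv ?F ?H" using assms by (rule equiv_homotopy)
  \<comment> \<open>With \<open>c\<close> sending a chain map to its homotopy class, the left-hand
    union is the quotient set.\<close>
  have "((\<Union>f\<in>F. {c f}) = {c z}) \<longleftrightarrow> (\<forall>f\<in>F. c f = c z)" if "z \<in> F"
    for F :: "'x set" and c :: "'x \<Rightarrow> 'y" and z
    using that by auto
  from this[OF z, of "\<lambda>f. ?H `` {f}"]
  have "KHom_vanishes R C D \<longleftrightarrow> (\<forall>f \<in> ?F. ?H `` {f} = ?H `` {?z})"
    unfolding KHom_vanishes_def KHom_def quotient_def .
  also have "\<dots> \<longleftrightarrow> (\<forall>f \<in> ?F. (f, ?z) \<in> ?H)"
    by (rule ball_cong[OF refl]) (rule eq_equiv_class_iff[OF eq _ z])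
  finally show ?thesis .
qed

lemma K_iso_sym: "K_iso R C D \<Longrightarrow> K_iso R D C"
  unfolding K_iso_def by blast

lemma K_iso_refl:
  assumes "precomplex R C"
  shows "K_iso R C C"
proof -
  have "(\<lambda>i. id \<circ> id, \<lambda>i. id) \<in> homotopy R C C"
    using assms by (intro homotopy_refl) (auto simp: id_chain_map)
  then show ?thesis
    unfolding K_iso_def using id_chain_map by (intro bexI conjI)
qed

text \<open>For \<open>f\<close> on \<open>C'\<close>, the composite \<open>f u\<close> is
  null-homotopic on \<open>C\<close>, hence so is \<open>f u v\<close>, and \<open>u v\<close> is
  homotopic to the identity. The statement for the target is dual, with
  \<open>u v f\<close>.\<close>

lemma KHom_vanishes_K_iso_left:
  assumes C: "precomplex R C" and C': "precomplex R C'" and D: "precomplex R D"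
    and iso: "K_iso R C C'" and van: "KHom_vanishes R C D"
  shows "KHom_vanishes R C' D"
  unfolding KHom_vanishes_iff[OF C' D]
proof
  fix f assume f: "f \<in> chain_maps R C' D"
  obtain u v where u: "u \<in> chain_maps R C C'" and v: "v \<in> chain_maps R C' C"
    and uv: "(\<lambda>i. u i \<circ> v i, \<lambda>i. id) \<in> homotopy R C' C'"
    using iso unfolding K_iso_def by blast
  have "(\<lambda>i. f i \<circ> u i, \<lambda>i x. \<zero>\<^bsub>Ob D i\<^esub>) \<in> homotopy R C D"
    using van comp_chain_map[OF u f] unfolding KHom_vanishes_iff[OF C D] by blast
  from homotopy_comp_right[OF C' this v]
  have 1: "(\<lambda>i. f i \<circ> (u i \<circ> v i), \<lambda>i x. \<zero>\<^bsub>Ob D i\<^esub>) \<in> homotopy R C' D"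
    by (simp add: comp_def)
  from homotopy_comp_left[OF C' C' D uv f]
  have 2: "(\<lambda>i. f i \<circ> (u i \<circ> v i), f) \<in> homotopy R C' D"
    by simp
  show "(f, \<lambda>i x. \<zero>\<^bsub>Ob D i\<^esub>) \<in> homotopy R C' D"
    using homotopy_trans[OF C' D homotopy_sym[OF C' D 2] 1] .
qed

lemma KHom_vanishes_K_iso_right:
  assumes C: "precomplex R C" and D: "precomplex R D" and D': "precomplex R D'"
    and iso: "K_iso R D D'" and van: "KHom_vanishes R C D"
  shows "KHom_vanishes R C D'"
  unfolding KHom_vanishes_iff[OF C D']
proof
  fix f assume f: "f \<in> chain_maps R C D'"
  obtain u v where u: "u \<in> chain_maps R D D'" and v: "v \<in> chain_maps R D' D"
    and uv: "(\<lambda>i. u i \<circ> v i, \<lambda>i. id) \<in> homotopy R D' D'"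
    using iso unfolding K_iso_def by blast
  have vf: "(\<lambda>i. v i \<circ> f i, \<lambda>i x. \<zero>\<^bsub>Ob D i\<^esub>) \<in> homotopy R C D"
    using van comp_chain_map[OF f v] unfolding KHom_vanishes_iff[OF C D] by blast
  have "u i \<zero>\<^bsub>Ob D i\<^esub> = \<zero>\<^bsub>Ob D' i\<^esub>" for i
    using chain_maps_mod_hom[OF u] precomplex_abelian_group[OF D] precomplex_abelian_group[OF D']
    by (rule mod_hom_zero)
  then have 1: "(\<lambda>i. (u i \<circ> v i) \<circ> f i, \<lambda>i x. \<zero>\<^bsub>Ob D' i\<^esub>) \<in> homotopy R C D'"
    using homotopy_comp_left[OF C D D' vf u] by (simp add: comp_def)
  from homotopy_comp_right[OF C uv f]
  have 2: "(\<lambda>i. (u i \<circ> v i) \<circ> f i, f) \<in> homotopy R C D'"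
    by simp
  show "(f, \<lambda>i x. \<zero>\<^bsub>Ob D' i\<^esub>) \<in> homotopy R C D'"
    using homotopy_trans[OF C D' homotopy_sym[OF C D' 2] 1] .
qed

section \<open>The shift\<close>

lemma Ob_shift: "Ob (shift C) i = Ob C (i + 1)"
  by (simp add: shift_def)

lemma dif_shift: "dif (shift C) i x = \<ominus>\<^bsub>Ob C (i + 2)\<^esub> dif C (i + 1) x"
  by (simp add: shift_def)

lemma dif_shift_pred: "dif (shift C) (i - 1) x = \<ominus>\<^bsub>Ob C (i + 1)\<^esub> dif C i x"
  by (simp add: dif_shift add.commute)

lemma precomplex_shift:
  assumes "precomplex R C" shows "precomplex R (shift C)"
proof -
  have "(\<lambda>x. \<ominus>\<^bsub>Ob C (i + 2)\<^esub> dif C (i + 1) x) \<in> mod_hom R (Ob C (i + 1)) (Ob C (i + 2))" for i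
    using minus_mod_hom[OF precomplex_left_module[OF assms] precomplex_dif[OF assms, of "i + 1"]]
    by (simp add: add.assoc)
  then show ?thesis
    using precomplex_left_module[OF assms] by (simp add: precomplex_def shift_def add.assoc)
qed

text \<open>The sign of the shifted differential appears on both sides of the commutation rule, so
  chain maps are merely reindexed.\<close>

lemma chain_maps_shift:
  assumes C: "precomplex R C" and D: "precomplex R D" and f: "f \<in> chain_maps R C D"
  shows "(\<lambda>i. f (i + 1)) \<in> chain_maps R (shift C) (shift D)"
proof -
  have "f (i + 1 + 1) (dif (shift C) i x) = dif (shift D) i (f (i + 1) x)"
    if "x \<in> carrier (Ob C (i + 1))" for i x
  proof -
    have "dif C (i + 1) x \<in> carrier (Ob C (i + 2))"
      using mod_hom_closed[OF precomplex_dif[OF C] that] by (simp add: add.assoc)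
    then show ?thesis
      using chain_maps_dif[OF f that]
        mod_hom_minus[OF chain_maps_mod_hom[OF f] precomplex_abelian_group[OF C] precomplex_abelian_group[OF D]]
      by (simp add: dif_shift add.assoc)
  qed
  then show ?thesis
    unfolding chain_maps_def using chain_maps_mod_hom[OF f] by (simp add: Ob_shift)
qed

text \<open>Desuspension is performed on maps, by reindexing with \<open>i - 1\<close>; the two
  signs are cancelled by injectivity of negation.\<close>

lemma chain_maps_shiftD:
  assumes C: "precomplex R C" and D: "precomplex R D" and f: "f \<in> chain_maps R (shift C) (shift D)"
  shows "(\<lambda>i. f (i - 1)) \<in> chain_maps R C D"
proof -
  have hom: "f (i - 1) \<in> mod_hom R (Ob C i) (Ob D i)" for i
    using chain_maps_mod_hom[OF f, of "i - 1"] by (simp add: Ob_shift)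
  have "f i (dif C i x) = dif D i (f (i - 1) x)" if x: "x \<in> carrier (Ob C i)" for i x
  proof -
    interpret abelian_group "Ob D (i + 1)" by (rule precomplex_abelian_group[OF D])
    have 1: "dif C i x \<in> carrier (Ob C (i + 1))"
      using mod_hom_closed[OF precomplex_dif[OF C] x] .
    have 2: "f i (dif C i x) \<in> carrier (Ob D (i + 1))"
      using mod_hom_closed[OF hom[of "i + 1"]] 1 by simp
    have 3: "dif D i (f (i - 1) x) \<in> carrier (Ob D (i + 1))"
      using mod_hom_closed[OF precomplex_dif[OF D] mod_hom_closed[OF hom x]] .
    have "f i (\<ominus>\<^bsub>Ob C (i + 1)\<^esub> dif C i x) = \<ominus>\<^bsub>Ob D (i + 1)\<^esub> dif D i (f (i - 1) x)"
      using chain_maps_dif[OF f, of x "i - 1"] x by (simp add: Ob_shift dif_shift add.commute)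
    moreover have "f i (\<ominus>\<^bsub>Ob C (i + 1)\<^esub> dif C i x) = \<ominus>\<^bsub>Ob D (i + 1)\<^esub> f i (dif C i x)"
      using mod_hom_minus[OF hom[of "i + 1"] precomplex_abelian_group[OF C] precomplex_abelian_group[OF D] 1]
      by simp
    ultimately show ?thesis
      using 2 3 by (metis minus_minus)
  qed
  then show ?thesis
    unfolding chain_maps_def using hom by simp
qed

text \<open>Unlike chain maps, homotopies change sign: the shifted differentials are negated, and
  \<open>- s\<close> restores the sum of both homotopy terms.\<close>

lemma homotopy_shift:
  assumes C: "precomplex R C" and D: "precomplex R D" and "(f, g) \<in> homotopy R C D"
  shows "(\<lambda>i. f (i + 1), \<lambda>i. g (i + 1)) \<in> homotopy R (shift C) (shift D)"
proof -
  obtain s where f: "f \<in> chain_maps R C D" and g: "g \<in> chain_maps R C D"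
    and s: "\<And>i. s i \<in> mod_hom R (Ob C i) (Ob D (i - 1))"
    and eq: "\<And>i x. x \<in> carrier (Ob C i) \<Longrightarrow>
      f i x = g i x \<oplus>\<^bsub>Ob D i\<^esub> (dif D (i - 1) (s i x) \<oplus>\<^bsub>Ob D i\<^esub> s (i + 1) (dif C i x))"
    using assms(3) by (rule homotopyE) blast
  show ?thesis
  proof (rule homotopyI[where s = "\<lambda>i x. \<ominus>\<^bsub>Ob D i\<^esub> s (i + 1) x"])
    fix i
    show "(\<lambda>x. \<ominus>\<^bsub>Ob D i\<^esub> s (i + 1) x) \<in> mod_hom R (Ob (shift C) i) (Ob (shift D) (i - 1))"
      using minus_mod_hom[OF precomplex_left_module[OF D], of "s (i + 1)"] s[of "i + 1"]
      by (simp add: Ob_shift)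
    fix x assume "x \<in> carrier (Ob (shift C) i)"
    then have x: "x \<in> carrier (Ob C (i + 1))" by (simp add: Ob_shift)
    interpret abelian_group "Ob D (i + 1)" by (rule precomplex_abelian_group[OF D])
    have 1: "dif C (i + 1) x \<in> carrier (Ob C (i + 2))"
      using mod_hom_closed[OF precomplex_dif[OF C] x] by (simp add: add.assoc)
    have 2: "s (i + 2) (\<ominus>\<^bsub>Ob C (i + 2)\<^esub> dif C (i + 1) x) = \<ominus>\<^bsub>Ob D (i + 1)\<^esub> s (i + 2) (dif C (i + 1) x)"
      using mod_hom_minus[OF s[of "i + 2"] precomplex_abelian_group[OF C] precomplex_abelian_group[OF D] 1]
      by (simp add: add.commute)
    have "s (i + 1) x \<in> carrier (Ob D i)"
      using mod_hom_closed[OF s[of "i + 1"] x] by simp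
    then have 3: "dif D i (\<ominus>\<^bsub>Ob D i\<^esub> s (i + 1) x) = \<ominus>\<^bsub>Ob D (i + 1)\<^esub> dif D i (s (i + 1) x)"
      by (rule mod_hom_minus[OF precomplex_dif[OF D] precomplex_abelian_group[OF D] precomplex_abelian_group[OF D]])
    show "f (i + 1) x = g (i + 1) x \<oplus>\<^bsub>Ob (shift D) i\<^esub>
        (dif (shift D) (i - 1) (\<ominus>\<^bsub>Ob D i\<^esub> s (i + 1) x) \<oplus>\<^bsub>Ob (shift D) i\<^esub>
         \<ominus>\<^bsub>Ob D (i + 1)\<^esub> s (i + 1 + 1) (dif (shift C) i x))"
      using eq[OF x] homotopy_terms_closed[OF C D s x]
      by (simp add: Ob_shift dif_shift[of _ i] dif_shift_pred 2 3 add.assoc)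
  qed (rule chain_maps_shift[OF C D f] chain_maps_shift[OF C D g])+
qed

lemma homotopy_shiftD:
  assumes C: "precomplex R C" and D: "precomplex R D"
    and "(f, g) \<in> homotopy R (shift C) (shift D)"
  shows "(\<lambda>i. f (i - 1), \<lambda>i. g (i - 1)) \<in> homotopy R C D"
proof -
  obtain s where f: "f \<in> chain_maps R (shift C) (shift D)" and g: "g \<in> chain_maps R (shift C) (shift D)"
    and s': "\<And>i. s i \<in> mod_hom R (Ob (shift C) i) (Ob (shift D) (i - 1))"
    and eq: "\<And>i x. x \<in> carrier (Ob (shift C) i) \<Longrightarrow>
      f i x = g i x \<oplus>\<^bsub>Ob (shift D) i\<^esub>
        (dif (shift D) (i - 1) (s i x) \<oplus>\<^bsub>Ob (shift D) i\<^esub> s (i + 1) (dif (shift C) i x))"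
    using assms(3) by (rule homotopyE) blast
  have s: "s (i - 1) \<in> mod_hom R (Ob C i) (Ob D (i - 1))" for i
    using s'[of "i - 1"] by (simp add: Ob_shift)
  show ?thesis
  proof (rule homotopyI[where s = "\<lambda>i x. \<ominus>\<^bsub>Ob D (i - 1)\<^esub> s (i - 1) x"])
    fix i
    show "(\<lambda>x. \<ominus>\<^bsub>Ob D (i - 1)\<^esub> s (i - 1) x) \<in> mod_hom R (Ob C i) (Ob D (i - 1))"
      by (rule minus_mod_hom[OF precomplex_left_module[OF D] s])
    fix x assume x: "x \<in> carrier (Ob C i)"
    have 1: "dif C i x \<in> carrier (Ob C (i + 1))"
      using mod_hom_closed[OF precomplex_dif[OF C] x] .
    have 2: "s i (\<ominus>\<^bsub>Ob C (i + 1)\<^esub> dif C i x) = \<ominus>\<^bsub>Ob D i\<^esub> s i (dif C i x)"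
      using mod_hom_minus[OF s[of "i + 1"] precomplex_abelian_group[OF C] precomplex_abelian_group[OF D]] 1
      by simp
    have 3: "dif D (i - 1) (\<ominus>\<^bsub>Ob D (i - 1)\<^esub> s (i - 1) x) = \<ominus>\<^bsub>Ob D i\<^esub> dif D (i - 1) (s (i - 1) x)"
      by (rule mod_hom_minus[OF precomplex_dif_pred[OF D] precomplex_abelian_group[OF D]
            precomplex_abelian_group[OF D] mod_hom_closed[OF s x]])
    show "f (i - 1) x = g (i - 1) x \<oplus>\<^bsub>Ob D i\<^esub>
        (dif D (i - 1) (\<ominus>\<^bsub>Ob D (i - 1)\<^esub> s (i - 1) x) \<oplus>\<^bsub>Ob D i\<^esub>
         \<ominus>\<^bsub>Ob D (i + 1 - 1)\<^esub> s (i + 1 - 1) (dif C i x))"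
      using eq[of x "i - 1"] x by (simp add: Ob_shift dif_shift[of _ "i - 2"] dif_shift_pred 2 3)
  qed (rule chain_maps_shiftD[OF C D f] chain_maps_shiftD[OF C D g])+
qed

lemma KHom_vanishes_shift_iff:
  assumes C: "precomplex R C" and D: "precomplex R D"
  shows "KHom_vanishes R (shift C) (shift D) \<longleftrightarrow> KHom_vanishes R C D"
  unfolding KHom_vanishes_iff[OF C D] KHom_vanishes_iff[OF precomplex_shift[OF C] precomplex_shift[OF D]]
proof (intro iffI ballI)
  fix f assume *: "\<forall>f \<in> chain_maps R (shift C) (shift D).
      (f, \<lambda>i x. \<zero>\<^bsub>Ob (shift D) i\<^esub>) \<in> homotopy R (shift C) (shift D)"
    and f: "f \<in> chain_maps R C D"
  from homotopy_shiftD[OF C D *[rule_format, OF chain_maps_shift[OF C D f]]]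
  show "(f, \<lambda>i x. \<zero>\<^bsub>Ob D i\<^esub>) \<in> homotopy R C D"
    by (simp add: Ob_shift)
next
  fix f assume *: "\<forall>f \<in> chain_maps R C D. (f, \<lambda>i x. \<zero>\<^bsub>Ob D i\<^esub>) \<in> homotopy R C D"
    and f: "f \<in> chain_maps R (shift C) (shift D)"
  from homotopy_shift[OF C D *[rule_format, OF chain_maps_shiftD[OF C D f]]]
  show "(f, \<lambda>i x. \<zero>\<^bsub>Ob (shift D) i\<^esub>) \<in> homotopy R (shift C) (shift D)"
    by (simp add: Ob_shift)
qed

lemma K_iso_shift:
  assumes C: "precomplex R C" and D: "precomplex R D" and "K_iso R C D"
  shows "K_iso R (shift C) (shift D)"
proof -
  obtain u v where u: "u \<in> chain_maps R C D" and v: "v \<in> chain_maps R D C"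
    and vu: "(\<lambda>i. v i \<circ> u i, \<lambda>i. id) \<in> homotopy R C C"
    and uv: "(\<lambda>i. u i \<circ> v i, \<lambda>i. id) \<in> homotopy R D D"
    using assms(3) unfolding K_iso_def by blast
  show ?thesis
    unfolding K_iso_def
    using chain_maps_shift[OF C D u] chain_maps_shift[OF D C v]
      homotopy_shift[OF C C vu] homotopy_shift[OF D D uv]
    by (intro bexI conjI)
qed

section \<open>Iterated shifts\<close>

lemma Ob_shift_funpow: "Ob ((shift ^^ k) C) i = Ob C (i + int k)"
  by (induction k arbitrary: i) (simp_all add: Ob_shift add.assoc)

lemma precomplex_shift_funpow: "precomplex R C \<Longrightarrow> precomplex R ((shift ^^ k) C)"
  by (induction k) (simp_all add: precomplex_shift)

lemma K_iso_shift_funpow: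
  "precomplex R C \<Longrightarrow> precomplex R D \<Longrightarrow> K_iso R C D \<Longrightarrow> K_iso R ((shift ^^ k) C) ((shift ^^ k) D)"
  by (induction k) (simp_all add: K_iso_shift precomplex_shift_funpow)

text \<open>This is what allows objects of \<open>K_trunc\<close> to be exchanged for concentrated
  representatives on either side of Hom.\<close>

lemma KHom_vanishes_shift_funpow_K_iso:
  assumes x: "precomplex R x" and x': "precomplex R x'" and y: "precomplex R y" and y': "precomplex R y'"
    and xx': "K_iso R x x'" and yy': "K_iso R y y'"
  shows "KHom_vanishes R x ((shift ^^ k) y) \<longleftrightarrow> KHom_vanishes R x' ((shift ^^ k) y')"
proof -
  note ky = precomplex_shift_funpow[OF y, of k] and ky' = precomplex_shift_funpow[OF y', of k]
  have "KHom_vanishes R x ((shift ^^ k) y) \<longleftrightarrow> KHom_vanishes R x' ((shift ^^ k) y)"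
    using KHom_vanishes_K_iso_left[OF x x' ky xx'] KHom_vanishes_K_iso_left[OF x' x ky K_iso_sym[OF xx']]
    by (rule iffI)
  also have "\<dots> \<longleftrightarrow> KHom_vanishes R x' ((shift ^^ k) y')"
    using KHom_vanishes_K_iso_right[OF x' ky ky' K_iso_shift_funpow[OF y y' yy']]
      KHom_vanishes_K_iso_right[OF x' ky' ky K_iso_shift_funpow[OF y' y K_iso_sym[OF yy']]]
    by (rule iffI)
  finally show ?thesis .
qed

section \<open>Truncation\<close>

text \<open>Chain maps into \<open>T\<close> are zero from degree \<open>n\<close> on, and a
  homotopy component from degree \<open>i\<close> lands in degree \<open>i - 1\<close> of
  \<open>T\<close>, so it is zero for \<open>i > n\<close>. Thus only the modules up to degree
  \<open>n\<close> and the differentials between them matter.\<close>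

lemma KHom_vanishes_truncate_source:
  assumes C: "precomplex R C" and C': "precomplex R C'" and T: "precomplex R T"
    and zero: "\<And>i. n \<le> i \<Longrightarrow> carrier (Ob T i) = {\<zero>\<^bsub>Ob T i\<^esub>}"
    and Ob: "\<And>i. i \<le> n \<Longrightarrow> Ob C i = Ob C' i"
    and dif: "\<And>i x. i < n \<Longrightarrow> x \<in> carrier (Ob C i) \<Longrightarrow> dif C i x = dif C' i x"
    and van: "KHom_vanishes R C T"
  shows "KHom_vanishes R C' T"
  unfolding KHom_vanishes_iff[OF C' T]
proof
  \<comment> \<open>From degree \<open>n\<close> on every equation in \<open>T\<close> holds as soon
    as both sides lie in the carrier.\<close>
  have eq_T: "a = b" if "n \<le> i" "a \<in> carrier (Ob T i)" "b \<in> carrier (Ob T i)" for i a b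
    using that zero by auto
  fix f assume f: "f \<in> chain_maps R C' T"
  define f' where "f' = (\<lambda>i. if i \<le> n then f i else (\<lambda>x. \<zero>\<^bsub>Ob T i\<^esub>))"
  have hom: "f' i \<in> mod_hom R (Ob C i) (Ob T i)" for i
    using chain_maps_mod_hom[OF f, of i]
    by (simp add: f'_def Ob zero_mod_hom[OF precomplex_left_module[OF T]])
  have "f' (i + 1) (dif C i x) = dif T i (f' i x)" if x: "x \<in> carrier (Ob C i)" for i x
  proof (cases "i < n")
    case True
    then show ?thesis using chain_maps_dif[OF f, of x i] x by (simp add: f'_def Ob dif)
  next
    case False
    then have "n \<le> i + 1" by simp
    then show ?thesis
      by (rule eq_T[OF _ mod_hom_closed[OF hom mod_hom_closed[OF precomplex_dif[OF C] x]]
            mod_hom_closed[OF precomplex_dif[OF T] mod_hom_closed[OF hom x]]])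
  qed
  then have f': "f' \<in> chain_maps R C T"
    unfolding chain_maps_def using hom by simp
  have "(f', \<lambda>i x. \<zero>\<^bsub>Ob T i\<^esub>) \<in> homotopy R C T"
    using van f' unfolding KHom_vanishes_iff[OF C T] by (rule bspec)
  then obtain s where s: "\<And>i. s i \<in> mod_hom R (Ob C i) (Ob T (i - 1))"
    and eq: "\<And>i x. x \<in> carrier (Ob C i) \<Longrightarrow>
      f' i x = \<zero>\<^bsub>Ob T i\<^esub> \<oplus>\<^bsub>Ob T i\<^esub> (dif T (i - 1) (s i x) \<oplus>\<^bsub>Ob T i\<^esub> s (i + 1) (dif C i x))"
    by (rule homotopyE) blast
  \<comment> \<open>The component at \<open>i = n\<close> must be kept: it lands in degree
    \<open>n - 1\<close>, where \<open>T\<close> may be nonzero, and enters the homotopy equation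
    there.\<close>
  define s' where "s' = (\<lambda>i. if i \<le> n then s i else (\<lambda>x. \<zero>\<^bsub>Ob T (i - 1)\<^esub>))"
  have s': "s' i \<in> mod_hom R (Ob C' i) (Ob T (i - 1))" for i
    using s[of i] by (cases "i \<le> n") (simp_all add: s'_def Ob zero_mod_hom[OF precomplex_left_module[OF T]])
  show "(f, \<lambda>i x. \<zero>\<^bsub>Ob T i\<^esub>) \<in> homotopy R C' T"
  proof (rule homotopyI[OF f zero_chain_map[OF C' T] s'])
    fix i x assume x: "x \<in> carrier (Ob C' i)"
    interpret abelian_group "Ob T i" by (rule precomplex_abelian_group[OF T])
    note closed = mod_hom_closed[OF chain_maps_mod_hom[OF f] x] homotopy_terms_closed[OF C' T s' x]
    show "f i x = \<zero>\<^bsub>Ob T i\<^esub> \<oplus>\<^bsub>Ob T i\<^esub> (dif T (i - 1) (s' i x) \<oplus>\<^bsub>Ob T i\<^esub> s' (i + 1) (dif C' i x))"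
    proof (cases "i < n")
      case True
      with eq[of x i] x show ?thesis by (simp add: f'_def s'_def Ob dif)
    next
      case False
      then have "n \<le> i" by simp
      then show ?thesis by (rule eq_T) (use closed in auto)
    qed
  qed
qed

text \<open>Chain maps from \<open>C\<close> are zero up to degree \<open>n\<close>, and the lowest
  homotopy component that can be nonzero goes from degree \<open>n + 1\<close> to degree
  \<open>n\<close>. Agreement of the targets is therefore required from \<open>n\<close> itself
  on.\<close>

lemma KHom_vanishes_truncate_target:
  assumes C: "precomplex R C" and T: "precomplex R T" and T': "precomplex R T'"
    and zero: "\<And>i. i \<le> n \<Longrightarrow> carrier (Ob C i) = {\<zero>\<^bsub>Ob C i\<^esub>}"
    and Ob: "\<And>i. n \<le> i \<Longrightarrow> Ob T i = Ob T' i"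
    and dif: "\<And>i x. n \<le> i \<Longrightarrow> x \<in> carrier (Ob T i) \<Longrightarrow> dif T i x = dif T' i x"
    and van: "KHom_vanishes R C T"
  shows "KHom_vanishes R C T'"
  unfolding KHom_vanishes_iff[OF C T']
proof
  note ab = precomplex_abelian_group[OF C] precomplex_abelian_group[OF T] precomplex_abelian_group[OF T']
  have dif_zero: "dif C i \<zero>\<^bsub>Ob C i\<^esub> = \<zero>\<^bsub>Ob C (i + 1)\<^esub>" "dif T i \<zero>\<^bsub>Ob T i\<^esub> = \<zero>\<^bsub>Ob T (i + 1)\<^esub>"
    "dif T' (i - 1) \<zero>\<^bsub>Ob T' (i - 1)\<^esub> = \<zero>\<^bsub>Ob T' i\<^esub>" for i
    using mod_hom_zero[OF precomplex_dif[OF C]] mod_hom_zero[OF precomplex_dif[OF T]]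
      mod_hom_zero[OF precomplex_dif_pred[OF T']] ab by blast+
  fix f assume f: "f \<in> chain_maps R C T'"
  define f' where "f' = (\<lambda>i. if n \<le> i then f i else (\<lambda>x. \<zero>\<^bsub>Ob T i\<^esub>))"
  have hom: "f' i \<in> mod_hom R (Ob C i) (Ob T i)" for i
    using chain_maps_mod_hom[OF f, of i]
    by (simp add: f'_def Ob zero_mod_hom[OF precomplex_left_module[OF T]])
  have "f' (i + 1) (dif C i x) = dif T i (f' i x)" if x: "x \<in> carrier (Ob C i)" for i x
  proof (cases "n < i")
    case True
    then have "f i x \<in> carrier (Ob T i)"
      using mod_hom_closed[OF chain_maps_mod_hom[OF f] x] by (simp add: Ob)
    then show ?thesis
      using True chain_maps_dif[OF f, of x i] x by (simp add: f'_def Ob dif)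
  next
    case False
    then have "x = \<zero>\<^bsub>Ob C i\<^esub>" using x zero by auto
    then show ?thesis
      using mod_hom_zero[OF hom ab(1,2)] by (simp add: dif_zero)
  qed
  then have f': "f' \<in> chain_maps R C T"
    unfolding chain_maps_def using hom by simp
  have "(f', \<lambda>i x. \<zero>\<^bsub>Ob T i\<^esub>) \<in> homotopy R C T"
    using van f' unfolding KHom_vanishes_iff[OF C T] by (rule bspec)
  then obtain s where s: "\<And>i. s i \<in> mod_hom R (Ob C i) (Ob T (i - 1))"
    and eq: "\<And>i x. x \<in> carrier (Ob C i) \<Longrightarrow>
      f' i x = \<zero>\<^bsub>Ob T i\<^esub> \<oplus>\<^bsub>Ob T i\<^esub> (dif T (i - 1) (s i x) \<oplus>\<^bsub>Ob T i\<^esub> s (i + 1) (dif C i x))"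
    by (rule homotopyE) blast
  \<comment> \<open>The cut is strict because \<open>s i\<close> lands in degree
    \<open>i - 1\<close>, which has to be at least \<open>n\<close> for \<open>T\<close> and
    \<open>T'\<close> to agree.\<close>
  define s' where "s' = (\<lambda>i. if n < i then s i else (\<lambda>x. \<zero>\<^bsub>Ob T' (i - 1)\<^esub>))"
  have s': "s' i \<in> mod_hom R (Ob C i) (Ob T' (i - 1))" for i
    using s[of i] by (cases "n < i") (simp_all add: s'_def Ob zero_mod_hom[OF precomplex_left_module[OF T']])
  show "(f, \<lambda>i x. \<zero>\<^bsub>Ob T' i\<^esub>) \<in> homotopy R C T'"
  proof (rule homotopyI[OF f zero_chain_map[OF C T'] s'])
    fix i x assume x: "x \<in> carrier (Ob C i)"
    interpret abelian_group "Ob T' i" by (rule precomplex_abelian_group[OF T'])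
    show "f i x = \<zero>\<^bsub>Ob T' i\<^esub> \<oplus>\<^bsub>Ob T' i\<^esub>
        (dif T' (i - 1) (s' i x) \<oplus>\<^bsub>Ob T' i\<^esub> s' (i + 1) (dif C i x))"
    proof (cases "n < i")
      case True
      with eq[of x i] x mod_hom_closed[OF s x] show ?thesis by (simp add: f'_def s'_def Ob dif)
    next
      case False
      then have "x = \<zero>\<^bsub>Ob C i\<^esub>" using x zero by auto
      then show ?thesis
        using mod_hom_zero[OF chain_maps_mod_hom[OF f, of i] ab(1,3)] mod_hom_zero[OF s'[of i] ab(1,3)]
          mod_hom_zero[OF s'[of "i + 1"] ab(1,3)]
        by (simp add: dif_zero)
    qed
  qed
qed

section \<open>Syzygies and cosyzygies\<close>

definition concentrated :: "nat \<Rightarrow> 'a cplx \<Rightarrow> bool" where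
  "concentrated d C \<longleftrightarrow> (\<forall>i. i \<notin> {- int d + 1..0} \<longrightarrow> carrier (Ob C i) = {\<zero>\<^bsub>Ob C i\<^esub>})"

lemma concentratedD:
  "concentrated d C \<Longrightarrow> 0 < i \<or> i \<le> - int d \<Longrightarrow> carrier (Ob C i) = {\<zero>\<^bsub>Ob C i\<^esub>}"
  by (auto simp: concentrated_def)

lemma Kb_projI:
  assumes "\<And>i. Ob C i \<in> proj R" "\<And>i. dif C i \<in> mod_hom R (Ob C i) (Ob C (i + 1))"
    and "\<And>i x. x \<in> carrier (Ob C i) \<Longrightarrow> dif C (i + 1) (dif C i x) = \<zero>\<^bsub>Ob C (i + 2)\<^esub>"
    and "concentrated d C"
  shows "C \<in> Kb_proj R"
proof -
  have "{i. carrier (Ob C i) \<noteq> {\<zero>\<^bsub>Ob C i\<^esub>}} \<subseteq> {- int d + 1..0}"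
    using assms(4) by (auto simp: concentrated_def)
  then have "finite {i. carrier (Ob C i) \<noteq> {\<zero>\<^bsub>Ob C i\<^esub>}}"
    by (rule finite_subset) simp
  then show ?thesis
    using assms(1-3) by (simp add: Kb_proj_def)
qed

lemma Kb_projD:
  assumes "C \<in> Kb_proj R"
  shows "Ob C i \<in> proj R" and "x \<in> carrier (Ob C i) \<Longrightarrow> dif C (i + 1) (dif C i x) = \<zero>\<^bsub>Ob C (i + 2)\<^esub>"
  using assms by (auto simp: Kb_proj_def)

lemma K_trunc_precomplex: "C \<in> K_trunc R d \<Longrightarrow> precomplex R C"
  by (simp add: K_trunc_def Kb_proj_precomplex)

lemma concentrated_K_trunc: "C \<in> Kb_proj R \<Longrightarrow> concentrated d C \<Longrightarrow> C \<in> K_trunc R d"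
  unfolding K_trunc_def concentrated_def by (blast intro: K_iso_refl Kb_proj_precomplex)

lemma K_truncE:
  assumes "C \<in> K_trunc R d"
  obtains D where "D \<in> Kb_proj R" "concentrated d D" "D \<in> K_trunc R d" "K_iso R C D"
proof -
  obtain D where D: "D \<in> Kb_proj R" "concentrated d D" "K_iso R C D"
    using assms unfolding K_trunc_def concentrated_def by blast
  then show thesis using that concentrated_K_trunc by blast
qed

text \<open>
  The syzygy is the desuspension of the brutal truncation of \<open>D\<close> to degrees \<open>\<le> -1\<close>, the cosyzygy the
  suspension of its truncation to degrees \<open>\<ge> -d+2\<close>. Both are meant for \<open>D\<close> concentrated in degrees
  \<open>-d+1, \<dots>, 0\<close>, whose terms in degrees \<open>1\<close> and \<open>-d\<close> then serve as zero objects.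
\<close>

definition syzygy :: "'a cplx \<Rightarrow> 'a cplx" where
  "syzygy D = \<lparr>Ob = (\<lambda>i. if i \<le> 0 then Ob D (i - 1) else Ob D 1),
     dif = (\<lambda>i x. if i < 0 then \<ominus>\<^bsub>Ob D i\<^esub> dif D (i - 1) x else \<zero>\<^bsub>Ob D 1\<^esub>)\<rparr>"

definition cosyzygy :: "nat \<Rightarrow> 'a cplx \<Rightarrow> 'a cplx" where
  "cosyzygy d D = \<lparr>Ob = (\<lambda>i. if 1 - int d \<le> i then Ob D (i + 1) else Ob D (- int d)),
     dif = (\<lambda>i x. if 1 - int d \<le> i then \<ominus>\<^bsub>Ob D (i + 2)\<^esub> dif D (i + 1) x
       else if 1 - int d \<le> i + 1 then \<zero>\<^bsub>Ob D (i + 2)\<^esub> else \<zero>\<^bsub>Ob D (- int d)\<^esub>)\<rparr>"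

lemma concentrated_syzygy: "concentrated d D \<Longrightarrow> concentrated d (syzygy D)"
  by (auto simp: concentrated_def syzygy_def)

lemma concentrated_cosyzygy: "concentrated d D \<Longrightarrow> concentrated d (cosyzygy d D)"
  by (auto simp: concentrated_def cosyzygy_def)

text \<open>This gives the square-zero condition for \<open>syzygy\<close> and
  \<open>cosyzygy\<close>, whose differentials carry the sign of a (de)suspension.\<close>

lemma minus_dif_minus_dif:
  assumes C: "C \<in> Kb_proj R" and x: "x \<in> carrier (Ob C i)"
  shows "\<ominus>\<^bsub>Ob C (i + 2)\<^esub> dif C (i + 1) (\<ominus>\<^bsub>Ob C (i + 1)\<^esub> dif C i x) = \<zero>\<^bsub>Ob C (i + 2)\<^esub>"
proof -
  note C' = Kb_proj_precomplex[OF C]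
  interpret abelian_group "Ob C (i + 2)" by (rule precomplex_abelian_group[OF C'])
  have "dif C (i + 1) (\<ominus>\<^bsub>Ob C (i + 1)\<^esub> dif C i x) = \<ominus>\<^bsub>Ob C (i + 2)\<^esub> dif C (i + 1) (dif C i x)"
    using mod_hom_minus[OF precomplex_dif[OF C', of "i + 1"] precomplex_abelian_group[OF C']
        precomplex_abelian_group[OF C'] mod_hom_closed[OF precomplex_dif[OF C'] x]]
    by (simp add: add.assoc)
  then show ?thesis using Kb_projD(2)[OF C x] by simp
qed

lemma syzygy_Kb_proj:
  assumes D: "D \<in> Kb_proj R" "concentrated d D"
  shows "syzygy D \<in> Kb_proj R"
proof (rule Kb_projI[OF _ _ _ concentrated_syzygy[OF D(2)]])
  fix i
  note D' = Kb_proj_precomplex[OF D(1)]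
  show "Ob (syzygy D) i \<in> proj R"
    using Kb_projD(1)[OF D(1)] by (simp add: syzygy_def)
  show "dif (syzygy D) i \<in> mod_hom R (Ob (syzygy D) i) (Ob (syzygy D) (i + 1))"
    by (simp add: syzygy_def zero_mod_hom[OF precomplex_left_module[OF D']]
        minus_mod_hom[OF precomplex_left_module[OF D'] precomplex_dif_pred[OF D']])
  fix x assume "x \<in> carrier (Ob (syzygy D) i)"
  then show "dif (syzygy D) (i + 1) (dif (syzygy D) i x) = \<zero>\<^bsub>Ob (syzygy D) (i + 2)\<^esub>"
    using minus_dif_minus_dif[OF D(1), of x "i - 1"]
    by (cases "i \<le> 0") (simp_all add: syzygy_def add.commute)
qed

lemma cosyzygy_Kb_proj:
  assumes D: "D \<in> Kb_proj R" "concentrated d D"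
  shows "cosyzygy d D \<in> Kb_proj R"
proof (rule Kb_projI[OF _ _ _ concentrated_cosyzygy[OF D(2)]])
  fix i
  note D' = Kb_proj_precomplex[OF D(1)]
  show "Ob (cosyzygy d D) i \<in> proj R"
    using Kb_projD(1)[OF D(1)] by (simp add: cosyzygy_def)
  show "dif (cosyzygy d D) i \<in> mod_hom R (Ob (cosyzygy d D) i) (Ob (cosyzygy d D) (i + 1))"
    using minus_mod_hom[OF precomplex_left_module[OF D'] precomplex_dif[OF D', of "i + 1"]]
    by (simp add: cosyzygy_def zero_mod_hom[OF precomplex_left_module[OF D']] add.assoc)
  fix x assume x: "x \<in> carrier (Ob (cosyzygy d D) i)"
  show "dif (cosyzygy d D) (i + 1) (dif (cosyzygy d D) i x) = \<zero>\<^bsub>Ob (cosyzygy d D) (i + 2)\<^esub>"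
  proof (cases "1 - int d \<le> i")
    case True
    then show ?thesis
      using x minus_dif_minus_dif[OF D(1), of x "i + 1"] by (simp add: cosyzygy_def add.assoc)
  next
    case False
    \<comment> \<open>The inner differential is zero here. The outer one is a differential of
      \<open>D\<close> only for \<open>i = - int d\<close>, and there it has to be seen to preserve
      zero.\<close>
    interpret abelian_group "Ob D (i + 3)" by (rule precomplex_abelian_group[OF D'])
    have "dif D (i + 2) \<zero>\<^bsub>Ob D (i + 2)\<^esub> = \<zero>\<^bsub>Ob D (i + 3)\<^esub>"
      using mod_hom_zero[OF precomplex_dif[OF D', of "i + 2"] precomplex_abelian_group[OF D']
          precomplex_abelian_group[OF D']]
      by (simp add: add.assoc)
    then show ?thesis
      using False by (auto simp: cosyzygy_def add.assoc)
  qed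
qed

text \<open>After one more suspension the syzygy agrees with \<open>D\<close> in degrees up to -1,
  so truncating the source at -1 compares the two.\<close>

lemma KHom_vanishes_syzygy:
  assumes D: "D \<in> Kb_proj R" "concentrated d D" and y: "y \<in> K_trunc R d" and k: "1 \<le> k"
  shows "KHom_vanishes R (syzygy D) ((shift ^^ k) y) \<longleftrightarrow> KHom_vanishes R D ((shift ^^ Suc k) y)"
proof -
  obtain z where z: "z \<in> Kb_proj R" "concentrated d z" and iso: "K_iso R y z"
    using y by (rule K_truncE)
  note D' = Kb_proj_precomplex[OF D(1)] and z' = Kb_proj_precomplex[OF z(1)] and y' = K_trunc_precomplex[OF y]
  have S: "precomplex R (syzygy D)" by (rule Kb_proj_precomplex[OF syzygy_Kb_proj[OF D]])
  note kz = precomplex_shift_funpow[OF z']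
  \<comment> \<open>This is where \<open>1 \<le> k\<close> enters: in degree \<open>i\<close> the
    shifted complex is \<open>z\<close> in degree \<open>i + Suc k\<close>, which is positive
    already for \<open>i = -1\<close>.\<close>
  have zero: "carrier (Ob ((shift ^^ Suc k) z) i) = {\<zero>\<^bsub>Ob ((shift ^^ Suc k) z) i\<^esub>}" if "-1 \<le> i" for i
    unfolding Ob_shift_funpow using that k by (intro concentratedD[OF z(2)]) simp
  have Ob: "Ob (shift (syzygy D)) i = Ob D i" if "i \<le> -1" for i
    using that by (simp add: Ob_shift syzygy_def)
  have dif: "dif (shift (syzygy D)) i x = dif D i x" if "i < -1" and x: "x \<in> carrier (Ob D i)" for i x
  proof -
    interpret abelian_group "Ob D (i + 1)" by (rule precomplex_abelian_group[OF D'])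
    have "dif D i x \<in> carrier (Ob D (i + 1))"
      using mod_hom_closed[OF precomplex_dif[OF D'] x] .
    \<comment> \<open>\<open>shift\<close> negates in degree \<open>i + 2\<close> of the syzygy. As
      \<open>i < -1\<close>, this is not yet a padding term, so both signs live in
      \<open>Ob D (i + 1)\<close> and cancel.\<close>
    moreover have "Ob (syzygy D) (i + 2) = Ob D (i + 1)"
      using that(1) by (simp add: syzygy_def add.commute)
    moreover have "dif (syzygy D) (i + 1) x = \<ominus>\<^bsub>Ob D (i + 1)\<^esub> dif D i x"
      using that(1) by (simp add: syzygy_def)
    ultimately show ?thesis by (simp add: dif_shift)
  qed
  have "KHom_vanishes R (syzygy D) ((shift ^^ k) y) \<longleftrightarrow> KHom_vanishes R (syzygy D) ((shift ^^ k) z)"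
    by (rule KHom_vanishes_shift_funpow_K_iso[OF S S y' z' K_iso_refl[OF S] iso])
  also have "\<dots> \<longleftrightarrow> KHom_vanishes R (shift (syzygy D)) ((shift ^^ Suc k) z)"
    using KHom_vanishes_shift_iff[OF S kz] by simp
  also have "\<dots> \<longleftrightarrow> KHom_vanishes R D ((shift ^^ Suc k) z)"
  proof
    assume "KHom_vanishes R (shift (syzygy D)) ((shift ^^ Suc k) z)"
    then show "KHom_vanishes R D ((shift ^^ Suc k) z)"
      by (rule KHom_vanishes_truncate_source[OF precomplex_shift[OF S] D' kz, rotated -1, where n = "-1"])
        (use zero Ob dif in auto)
  next
    assume "KHom_vanishes R D ((shift ^^ Suc k) z)"
    then show "KHom_vanishes R (shift (syzygy D)) ((shift ^^ Suc k) z)"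
      by (rule KHom_vanishes_truncate_source[OF D' precomplex_shift[OF S] kz, rotated -1, where n = "-1"])
        (use zero Ob dif in auto)
  qed
  also have "\<dots> \<longleftrightarrow> KHom_vanishes R D ((shift ^^ Suc k) y)"
    by (rule KHom_vanishes_shift_funpow_K_iso[OF D' D' z' y' K_iso_refl[OF D'] K_iso_sym[OF iso]])
  finally show ?thesis .
qed

text \<open>Each shift negates the differential inside its target module, so agreement of
  differentials is propagated together with agreement of modules.\<close>

lemma dif_shift_funpow_cong:
  assumes "\<And>i. n \<le> i \<Longrightarrow> Ob C i = Ob D i"
    and "\<And>i x. n \<le> i \<Longrightarrow> x \<in> carrier (Ob C i) \<Longrightarrow> dif C i x = dif D i x"
    and "n \<le> i + int k" and "x \<in> carrier (Ob C (i + int k))"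
  shows "dif ((shift ^^ k) C) i x = dif ((shift ^^ k) D) i x"
  using assms(3,4)
proof (induction k arbitrary: i)
  case (Suc k)
  have "Ob C (i + 2 + int k) = Ob D (i + 2 + int k)"
    using Suc.prems(1) by (intro assms(1)) simp
  with Suc.IH[of "i + 1"] Suc.prems show ?case
    by (simp add: dif_shift Ob_shift_funpow add.assoc)
qed (use assms(2) in simp)

text \<open>The cosyzygy agrees with \<open>shift D\<close> from degree \<open>1 - int d\<close> on.
  At least one further shift moves this bound to \<open>- int d\<close> or below, up to which a
  concentrated source is zero.\<close>

lemma KHom_vanishes_cosyzygy:
  assumes D: "D \<in> Kb_proj R" "concentrated d D" and x: "x \<in> K_trunc R d" and k: "1 \<le> k"
  shows "KHom_vanishes R x ((shift ^^ k) (cosyzygy d D)) \<longleftrightarrow> KHom_vanishes R x ((shift ^^ Suc k) D)"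
proof -
  obtain z where z: "z \<in> Kb_proj R" "concentrated d z" and iso: "K_iso R x z"
    using x by (rule K_truncE)
  note D' = Kb_proj_precomplex[OF D(1)] and z' = Kb_proj_precomplex[OF z(1)] and x' = K_trunc_precomplex[OF x]
  have S: "precomplex R (cosyzygy d D)" by (rule Kb_proj_precomplex[OF cosyzygy_Kb_proj[OF D]])
  note kS = precomplex_shift_funpow[OF S, of k] and kD = precomplex_shift_funpow[OF precomplex_shift[OF D'], of k]
  have zero: "carrier (Ob z i) = {\<zero>\<^bsub>Ob z i\<^esub>}" if "i \<le> - int d" for i
    using that by (intro concentratedD[OF z(2)]) simp
  have Ob0: "Ob (cosyzygy d D) i = Ob (shift D) i" if "1 - int d \<le> i" for i
    using that by (simp add: Ob_shift cosyzygy_def)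
  have dif0: "dif (cosyzygy d D) i a = dif (shift D) i a" if "1 - int d \<le> i" for i a
    using that by (simp add: dif_shift cosyzygy_def)
  have Ob: "Ob ((shift ^^ k) (cosyzygy d D)) i = Ob ((shift ^^ k) (shift D)) i" if "- int d \<le> i" for i
    unfolding Ob_shift_funpow using that k by (intro Ob0) simp
  have dif: "dif ((shift ^^ k) (cosyzygy d D)) i a = dif ((shift ^^ k) (shift D)) i a"
    if "- int d \<le> i" "a \<in> carrier (Ob ((shift ^^ k) (cosyzygy d D)) i)" for i a
    using that k by (intro dif_shift_funpow_cong[of "1 - int d"] Ob0 dif0) (auto simp: Ob_shift_funpow)
  have "KHom_vanishes R x ((shift ^^ k) (cosyzygy d D)) \<longleftrightarrow> KHom_vanishes R z ((shift ^^ k) (cosyzygy d D))"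
    by (rule KHom_vanishes_shift_funpow_K_iso[OF x' z' S S iso K_iso_refl[OF S]])
  also have "\<dots> \<longleftrightarrow> KHom_vanishes R z ((shift ^^ k) (shift D))"
  proof
    assume "KHom_vanishes R z ((shift ^^ k) (cosyzygy d D))"
    then show "KHom_vanishes R z ((shift ^^ k) (shift D))"
      by (rule KHom_vanishes_truncate_target[OF z' kS kD, rotated -1, where n = "- int d"])
        (use zero Ob dif in auto)
  next
    assume "KHom_vanishes R z ((shift ^^ k) (shift D))"
    then show "KHom_vanishes R z ((shift ^^ k) (cosyzygy d D))"
      by (rule KHom_vanishes_truncate_target[OF z' kD kS, rotated -1, where n = "- int d"])
        (use zero Ob dif in auto)
  qed
  also have "\<dots> \<longleftrightarrow> KHom_vanishes R z ((shift ^^ Suc k) D)"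
    by (simp add: funpow_swap1)
  also have "\<dots> \<longleftrightarrow> KHom_vanishes R x ((shift ^^ Suc k) D)"
    by (rule KHom_vanishes_shift_funpow_K_iso[OF z' x' D' D' K_iso_sym[OF iso] K_iso_refl[OF D']])
  finally show ?thesis .
qed

section \<open>Hereditary cotorsion pairs\<close>

definition left_perp :: "('a, 'r) ring_scheme \<Rightarrow> nat \<Rightarrow> 'a cplx set \<Rightarrow> 'a cplx set" where
  "left_perp R d B = {x \<in> K_trunc R d. \<forall>y\<in>B. KHom_vanishes R x (shift y)}"

definition right_perp :: "('a, 'r) ring_scheme \<Rightarrow> nat \<Rightarrow> 'a cplx set \<Rightarrow> 'a cplx set" where
  "right_perp R d A = {y \<in> K_trunc R d. \<forall>x\<in>A. KHom_vanishes R x (shift y)}"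

lemma cotorsion_pair_iff: "cotorsion_pair R d (A, B) \<longleftrightarrow> A = left_perp R d B \<and> B = right_perp R d A"
  unfolding cotorsion_pair_def left_perp_def right_perp_def prod.case by blast

lemma cotorsion_pairD:
  assumes "cotorsion_pair R d (A, B)"
  shows "A = left_perp R d B" and "B = right_perp R d A"
  using assms unfolding cotorsion_pair_iff by (rule conjunct1, rule conjunct2)

text \<open>Vanishing of Hom(x, \<Sigma>\<Sigma>y) says that the syzygy of \<open>x\<close> is
  orthogonal to \<open>B\<close>, hence in \<open>A\<close>. Conversely, each passage to a syzygy
  lowers the exponent by one until the defining orthogonality is reached. The criterion mentions
  \<open>A\<close> alone, so it can be intersected.\<close>

lemma hereditary_iff_syzygy_closed:
  assumes "cotorsion_pair R d (A, B)"
  shows "hereditary R (A, B) \<longleftrightarrow> (\<forall>D \<in> A \<inter> Kb_proj R. concentrated d D \<longrightarrow> syzygy D \<in> A)"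
proof -
  have A: "x \<in> A \<longleftrightarrow> x \<in> K_trunc R d \<and> (\<forall>y\<in>B. KHom_vanishes R x ((shift ^^ 1) y))" for x
    by (subst cotorsion_pairD(1)[OF assms]) (simp add: left_perp_def)
  have B: "y \<in> K_trunc R d" if "y \<in> B" for y
    using that by (subst (asm) cotorsion_pairD(2)[OF assms]) (simp add: right_perp_def)
  show ?thesis
  proof
    assume her: "hereditary R (A, B)"
    have van: "KHom_vanishes R x ((shift ^^ k) y)" if "2 \<le> k" "x \<in> A" "y \<in> B" for k x y
      using her that unfolding hereditary_def prod.case by blast
    show "\<forall>D \<in> A \<inter> Kb_proj R. concentrated d D \<longrightarrow> syzygy D \<in> A"
    proof (intro ballI impI)
      fix D assume D: "D \<in> A \<inter> Kb_proj R" "concentrated d D"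
      have "KHom_vanishes R (syzygy D) ((shift ^^ 1) y)" if y: "y \<in> B" for y
      proof -
        have "KHom_vanishes R D ((shift ^^ Suc 1) y)"
          using D(1) y by (intro van) auto
        then show ?thesis
          using KHom_vanishes_syzygy[OF _ D(2) B[OF y] order_refl] D(1) by blast
      qed
      moreover have "syzygy D \<in> K_trunc R d"
        using D by (intro concentrated_K_trunc syzygy_Kb_proj concentrated_syzygy) auto
      ultimately show "syzygy D \<in> A"
        unfolding A by blast
    qed
  next
    assume syz: "\<forall>D \<in> A \<inter> Kb_proj R. concentrated d D \<longrightarrow> syzygy D \<in> A"
    \<comment> \<open>The induction starts at exponent 1, where vanishing is the orthogonality of
      the pair, although \<open>hereditary\<close> asks only for exponents from 2 on.\<close>
    have van: "\<forall>x\<in>A. \<forall>y\<in>B. KHom_vanishes R x ((shift ^^ k) y)" if "1 \<le> k" for k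
      using that
    proof (induction k rule: dec_induct)
      case base
      show ?case
        by (intro ballI) (rule A[THEN iffD1, THEN conjunct2, THEN bspec])
    next
      case (step k)
      show ?case
      proof (intro ballI)
        fix x y assume x: "x \<in> A" and y: "y \<in> B"
        have tr: "x \<in> K_trunc R d" using x unfolding A by (rule conjunct1)
        then obtain D where D: "D \<in> Kb_proj R" "concentrated d D" "D \<in> K_trunc R d" "K_iso R x D"
          by (rule K_truncE)
        have iso: "KHom_vanishes R x ((shift ^^ l) z) \<longleftrightarrow> KHom_vanishes R D ((shift ^^ l) z)" if "z \<in> B" for l z
          by (rule KHom_vanishes_shift_funpow_K_iso[OF _ _ _ _ D(4) K_iso_refl])
            (rule K_trunc_precomplex[OF tr] K_trunc_precomplex[OF D(3)] K_trunc_precomplex[OF B[OF that]])+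
        \<comment> \<open>\<open>A\<close> is closed under isomorphism, being defined by vanishing
          conditions; this makes the closure hypothesis applicable to the concentrated
          representative.\<close>
        have "D \<in> A"
          using D(3) x[unfolded A, THEN conjunct2] unfolding A by (simp only: iso ball_triv simp_thms cong: ball_cong)
        then have "syzygy D \<in> A"
          using syz D(1,2) by blast
        then have "KHom_vanishes R (syzygy D) ((shift ^^ k) y)"
          by (rule step.IH[THEN bspec, THEN bspec, OF _ y])
        then show "KHom_vanishes R x ((shift ^^ Suc k) y)"
          unfolding iso[OF y] KHom_vanishes_syzygy[OF D(1,2) B[OF y] step.hyps(1)] .
      qed
    qed
    show "hereditary R (A, B)"
      unfolding hereditary_def prod.case by (intro allI impI van) simp
  qed
qed

text \<open>The dual argument lowers the exponent by replacing \<open>y\<close> with a cosyzygy, and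
  leads to a criterion in \<open>B\<close> alone.\<close>

lemma hereditary_iff_cosyzygy_closed:
  assumes "cotorsion_pair R d (A, B)"
  shows "hereditary R (A, B) \<longleftrightarrow> (\<forall>D \<in> B \<inter> Kb_proj R. concentrated d D \<longrightarrow> cosyzygy d D \<in> B)"
proof -
  have B: "y \<in> B \<longleftrightarrow> y \<in> K_trunc R d \<and> (\<forall>x\<in>A. KHom_vanishes R x ((shift ^^ 1) y))" for y
    by (subst cotorsion_pairD(2)[OF assms]) (simp add: right_perp_def)
  have A: "x \<in> K_trunc R d" if "x \<in> A" for x
    using that by (subst (asm) cotorsion_pairD(1)[OF assms]) (simp add: left_perp_def)
  show ?thesis
  proof
    assume her: "hereditary R (A, B)"
    have van: "KHom_vanishes R x ((shift ^^ k) y)" if "2 \<le> k" "x \<in> A" "y \<in> B" for k x y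
      using her that unfolding hereditary_def prod.case by blast
    show "\<forall>D \<in> B \<inter> Kb_proj R. concentrated d D \<longrightarrow> cosyzygy d D \<in> B"
    proof (intro ballI impI)
      fix D assume D: "D \<in> B \<inter> Kb_proj R" "concentrated d D"
      have "KHom_vanishes R x ((shift ^^ 1) (cosyzygy d D))" if x: "x \<in> A" for x
      proof -
        have "KHom_vanishes R x ((shift ^^ Suc 1) D)"
          using D(1) x by (intro van) auto
        then show ?thesis
          using KHom_vanishes_cosyzygy[OF _ D(2) A[OF x] order_refl] D(1) by blast
      qed
      moreover have "cosyzygy d D \<in> K_trunc R d"
        using D by (intro concentrated_K_trunc cosyzygy_Kb_proj concentrated_cosyzygy) auto
      ultimately show "cosyzygy d D \<in> B"
        unfolding B by blast
    qed
  next
    assume cosyz: "\<forall>D \<in> B \<inter> Kb_proj R. concentrated d D \<longrightarrow> cosyzygy d D \<in> B"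
    have van: "\<forall>x\<in>A. \<forall>y\<in>B. KHom_vanishes R x ((shift ^^ k) y)" if "1 \<le> k" for k
      using that
    proof (induction k rule: dec_induct)
      case base
      show ?case
        by (intro ballI) (rule B[THEN iffD1, THEN conjunct2, THEN bspec])
    next
      case (step k)
      show ?case
      proof (intro ballI)
        fix x y assume x: "x \<in> A" and y: "y \<in> B"
        have tr: "y \<in> K_trunc R d" using y unfolding B by (rule conjunct1)
        then obtain D where D: "D \<in> Kb_proj R" "concentrated d D" "D \<in> K_trunc R d" "K_iso R y D"
          by (rule K_truncE)
        have iso: "KHom_vanishes R z ((shift ^^ l) y) \<longleftrightarrow> KHom_vanishes R z ((shift ^^ l) D)" if "z \<in> A" for l z
          by (rule KHom_vanishes_shift_funpow_K_iso[OF _ _ _ _ K_iso_refl D(4)])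
            (rule K_trunc_precomplex[OF tr] K_trunc_precomplex[OF D(3)] K_trunc_precomplex[OF A[OF that]])+
        have "D \<in> B"
          using D(3) y[unfolded B, THEN conjunct2] unfolding B by (simp only: iso ball_triv simp_thms cong: ball_cong)
        then have "cosyzygy d D \<in> B"
          using cosyz D(1,2) by blast
        then have "KHom_vanishes R x ((shift ^^ k) (cosyzygy d D))"
          by (rule step.IH[THEN bspec, OF x, THEN bspec])
        then show "KHom_vanishes R x ((shift ^^ Suc k) y)"
          unfolding iso[OF x] KHom_vanishes_cosyzygy[OF D(1,2) A[OF x] step.hyps(1)] .
      qed
    qed
    show "hereditary R (A, B)"
      unfolding hereditary_def prod.case by (intro allI impI van) simp
  qed
qed

section \<open>The lattice of cotorsion pairs\<close>

lemma subset_left_perp_right_perp: "A \<subseteq> K_trunc R d \<Longrightarrow> A \<subseteq> left_perp R d (right_perp R d A)"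
  by (auto simp: left_perp_def right_perp_def)

lemma subset_right_perp_left_perp: "B \<subseteq> K_trunc R d \<Longrightarrow> B \<subseteq> right_perp R d (left_perp R d B)"
  by (auto simp: left_perp_def right_perp_def)

lemma left_perp_right_perp_mono:
  "A \<subseteq> A' \<Longrightarrow> left_perp R d (right_perp R d A) \<subseteq> left_perp R d (right_perp R d A')"
  by (auto simp: left_perp_def right_perp_def)

lemma right_perp_left_perp_mono:
  "B \<subseteq> B' \<Longrightarrow> right_perp R d (left_perp R d B) \<subseteq> right_perp R d (left_perp R d B')"
  by (auto simp: left_perp_def right_perp_def)

text \<open>The double orthogonal is monotone and extensive, and it fixes \<open>A1\<close> and
  \<open>A2\<close>; hence it fixes their intersection.\<close>

lemma cotorsion_pair_Int_left:
  assumes 1: "cotorsion_pair R d (A1, B1)" and 2: "cotorsion_pair R d (A2, B2)"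
  shows "cotorsion_pair R d (A1 \<inter> A2, right_perp R d (A1 \<inter> A2))"
proof -
  have "left_perp R d (right_perp R d A1) = A1" "left_perp R d (right_perp R d A2) = A2"
    using cotorsion_pairD[OF 1] cotorsion_pairD[OF 2] by metis+
  moreover have "A1 \<inter> A2 \<subseteq> K_trunc R d"
    using 1 by (auto simp: cotorsion_pair_def)
  ultimately have "left_perp R d (right_perp R d (A1 \<inter> A2)) = A1 \<inter> A2"
    using left_perp_right_perp_mono[of "A1 \<inter> A2" A1 R d] left_perp_right_perp_mono[of "A1 \<inter> A2" A2 R d]
      subset_left_perp_right_perp[of "A1 \<inter> A2" R d] by (intro equalityI Int_greatest) simp_all
  then show ?thesis by (simp add: cotorsion_pair_iff)
qed

lemma cotorsion_pair_Int_right: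
  assumes 1: "cotorsion_pair R d (A1, B1)" and 2: "cotorsion_pair R d (A2, B2)"
  shows "cotorsion_pair R d (left_perp R d (B1 \<inter> B2), B1 \<inter> B2)"
proof -
  have "right_perp R d (left_perp R d B1) = B1" "right_perp R d (left_perp R d B2) = B2"
    using cotorsion_pairD[OF 1] cotorsion_pairD[OF 2] by metis+
  moreover have "B1 \<inter> B2 \<subseteq> K_trunc R d"
    using 1 by (auto simp: cotorsion_pair_def)
  ultimately have "right_perp R d (left_perp R d (B1 \<inter> B2)) = B1 \<inter> B2"
    using right_perp_left_perp_mono[of "B1 \<inter> B2" B1 R d] right_perp_left_perp_mono[of "B1 \<inter> B2" B2 R d]
      subset_right_perp_left_perp[of "B1 \<inter> B2" R d] by (intro equalityI Int_greatest) simp_all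
  then show ?thesis by (simp add: cotorsion_pair_iff)
qed

text \<open>Read on first components, the order is reverse inclusion, so upper bounds are the pairs
  whose first component lies in both \<open>A1\<close> and \<open>A2\<close>. Meets are read off
  directly, as \<open>cotors\<close> compares second components.\<close>

lemma cotors_least_Upper:
  assumes p: "(A1, B1) \<in> carrier (cotors R d)" and q: "(A2, B2) \<in> carrier (cotors R d)"
  shows "least (cotors R d) (A1 \<inter> A2, right_perp R d (A1 \<inter> A2)) (Upper (cotors R d) {(A1, B1), (A2, B2)})"
    (is "least _ ?j _")
proof (rule least_UpperI)
  have j: "?j \<in> carrier (cotors R d)"
    using p q by (simp add: cotors_def cotorsion_pair_Int_left)
  show "?j \<in> carrier (cotors R d)" by (fact j)
  show "{(A1, B1), (A2, B2)} \<subseteq> carrier (cotors R d)" using p q by simp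
  show "x \<sqsubseteq>\<^bsub>cotors R d\<^esub> ?j" if "x \<in> {(A1, B1), (A2, B2)}" for x
    using that by (auto simp: cotors_le_iff[OF p j] cotors_le_iff[OF q j])
  fix u assume u: "u \<in> Upper (cotors R d) {(A1, B1), (A2, B2)}"
  then have u: "u \<in> carrier (cotors R d)"
    "(A1, B1) \<sqsubseteq>\<^bsub>cotors R d\<^esub> u" "(A2, B2) \<sqsubseteq>\<^bsub>cotors R d\<^esub> u"
    using p q by (simp_all add: Upper_def)
  then have "fst u \<subseteq> A1" "fst u \<subseteq> A2"
    by (simp_all add: cotors_le_iff[OF p u(1)] cotors_le_iff[OF q u(1)])
  then show "?j \<sqsubseteq>\<^bsub>cotors R d\<^esub> u"
    using u(1) by (simp add: cotors_le_iff[OF j])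
qed

lemma cotors_greatest_Lower:
  assumes p: "(A1, B1) \<in> carrier (cotors R d)" and q: "(A2, B2) \<in> carrier (cotors R d)"
  shows "greatest (cotors R d) (left_perp R d (B1 \<inter> B2), B1 \<inter> B2) (Lower (cotors R d) {(A1, B1), (A2, B2)})"
    (is "greatest _ ?m _")
proof (rule greatest_LowerI)
  show "?m \<in> carrier (cotors R d)"
    using p q by (simp add: cotors_def cotorsion_pair_Int_right)
  show "{(A1, B1), (A2, B2)} \<subseteq> carrier (cotors R d)" using p q by simp
  show "?m \<sqsubseteq>\<^bsub>cotors R d\<^esub> x" if "x \<in> {(A1, B1), (A2, B2)}" for x
    using that by (auto simp: cotors_def)
  fix u assume "u \<in> Lower (cotors R d) {(A1, B1), (A2, B2)}"
  then show "u \<sqsubseteq>\<^bsub>cotors R d\<^esub> ?m"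
    using p q by (auto simp: Lower_def cotors_def)
qed

section \<open>The lattice structure and the hereditary pairs in it\<close>

lemma partial_order_cotors: "partial_order (cotors R d)"
proof
  fix p q assume p: "p \<in> carrier (cotors R d)" and q: "q \<in> carrier (cotors R d)"
    and le: "p \<sqsubseteq>\<^bsub>cotors R d\<^esub> q" "q \<sqsubseteq>\<^bsub>cotors R d\<^esub> p"
  have "fst p = fst q"
    using le unfolding cotors_le_iff[OF p q] cotors_le_iff[OF q p] by simp
  moreover have "snd p = snd q" using le by (auto simp: cotors_def)
  ultimately show "p .=\<^bsub>cotors R d\<^esub> q" by (simp add: cotors_def prod_eq_iff)
qed (auto simp: cotors_def)

lemma lattice_cotors: "lattice (cotors R d)"
proof -
  interpret partial_order "cotors R d" by (rule partial_order_cotors)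
  show ?thesis
  proof
    fix p q assume pq: "p \<in> carrier (cotors R d)" "q \<in> carrier (cotors R d)"
    obtain A1 B1 A2 B2 where "p = (A1, B1)" "q = (A2, B2)" by (cases p, cases q)
    with pq show "\<exists>s. least (cotors R d) s (Upper (cotors R d) {p, q})"
      "\<exists>s. greatest (cotors R d) s (Lower (cotors R d) {p, q})"
      using cotors_least_Upper[of A1 B1 R d A2 B2] cotors_greatest_Lower[of A1 B1 R d A2 B2] by auto
  qed
qed

text \<open>\<open>join\<close> is a choice among least upper bounds; antisymmetry makes the choice
  unique, so an explicit least upper bound can be substituted.\<close>

lemma (in partial_order) join_eqI: "least L s (Upper L {x, y}) \<Longrightarrow> x \<squnion> y = s"
  unfolding join_def sup_def by (rule some_equality) (auto simp: eq_is_equal dest: weak_least_unique)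

lemma (in partial_order) meet_eqI: "greatest L s (Lower L {x, y}) \<Longrightarrow> x \<sqinter> y = s"
  unfolding meet_def inf_def by (rule some_equality) (auto simp: eq_is_equal dest: weak_greatest_unique)

lemma sublattice_hereditary_cotors: "sublattice (cotors R d) (hereditary_cotors R d)"
  unfolding sublattice_def
proof (intro conjI ballI)
  interpret partial_order "cotors R d" by (rule partial_order_cotors)
  show "hereditary_cotors R d \<subseteq> carrier (cotors R d)"
    by (auto simp: hereditary_cotors_def cotors_def)
  fix p q assume p: "p \<in> hereditary_cotors R d" and q: "q \<in> hereditary_cotors R d"
  obtain A1 B1 A2 B2 where pq: "p = (A1, B1)" "q = (A2, B2)" by (cases p, cases q)
  have cot: "cotorsion_pair R d (A1, B1)" "cotorsion_pair R d (A2, B2)"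
    and her: "hereditary R (A1, B1)" "hereditary R (A2, B2)"
    using p q by (simp_all add: hereditary_cotors_def pq)
  have car: "(A1, B1) \<in> carrier (cotors R d)" "(A2, B2) \<in> carrier (cotors R d)"
    using cot by (simp_all add: cotors_def)
  \<comment> \<open>The join has an intersection as first component, so the syzygy criterion
    applies; for the meet below it is the cosyzygy criterion.\<close>
  have "hereditary R (A1 \<inter> A2, right_perp R d (A1 \<inter> A2))"
    using her unfolding hereditary_iff_syzygy_closed[OF cot(1)] hereditary_iff_syzygy_closed[OF cot(2)]
      hereditary_iff_syzygy_closed[OF cotorsion_pair_Int_left[OF cot]] by blast
  then show "p \<squnion>\<^bsub>cotors R d\<^esub> q \<in> hereditary_cotors R d"
    unfolding pq join_eqI[OF cotors_least_Upper[OF car]]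
    using cotorsion_pair_Int_left[OF cot] by (simp add: hereditary_cotors_def)
  have "hereditary R (left_perp R d (B1 \<inter> B2), B1 \<inter> B2)"
    using her unfolding hereditary_iff_cosyzygy_closed[OF cot(1)] hereditary_iff_cosyzygy_closed[OF cot(2)]
      hereditary_iff_cosyzygy_closed[OF cotorsion_pair_Int_right[OF cot]] by blast
  then show "p \<sqinter>\<^bsub>cotors R d\<^esub> q \<in> hereditary_cotors R d"
    unfolding pq meet_eqI[OF cotors_greatest_Lower[OF car]]
    using cotorsion_pair_Int_right[OF cot] by (simp add: hereditary_cotors_def)
qed

text \<open>The ambient join and meet lie in \<open>S\<close>, and bounds within \<open>S\<close>
  are ambient bounds that belong to \<open>S\<close>; so they stay extremal after
  restriction.\<close>

lemma (in lattice) lattice_sublattice: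
  assumes "sublattice L S"
  shows "lattice (L\<lparr>carrier := S\<rparr>)"
proof -
  have S: "S \<subseteq> carrier L" using assms by (simp add: sublattice_def)
  interpret S: partial_order "L\<lparr>carrier := S\<rparr>"
  proof
    fix x y z assume "x \<in> carrier (L\<lparr>carrier := S\<rparr>)" "y \<in> carrier (L\<lparr>carrier := S\<rparr>)"
      "z \<in> carrier (L\<lparr>carrier := S\<rparr>)"
    then have xyz: "x \<in> carrier L" "y \<in> carrier L" "z \<in> carrier L" using S by auto
    show "x \<sqsubseteq>\<^bsub>L\<lparr>carrier := S\<rparr>\<^esub> y \<Longrightarrow> y \<sqsubseteq>\<^bsub>L\<lparr>carrier := S\<rparr>\<^esub> z \<Longrightarrow> x \<sqsubseteq>\<^bsub>L\<lparr>carrier := S\<rparr>\<^esub> z"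
      using le_trans[OF _ _ xyz] by simp
  next
    fix x y assume "x \<in> carrier (L\<lparr>carrier := S\<rparr>)" "y \<in> carrier (L\<lparr>carrier := S\<rparr>)"
      "x \<sqsubseteq>\<^bsub>L\<lparr>carrier := S\<rparr>\<^esub> y" "y \<sqsubseteq>\<^bsub>L\<lparr>carrier := S\<rparr>\<^esub> x"
    moreover from this have "x \<in> carrier L" "y \<in> carrier L" using S by auto
    ultimately show "x .=\<^bsub>L\<lparr>carrier := S\<rparr>\<^esub> y"
      using le_antisym[of x y] by simp
  qed (use S in \<open>auto simp: eq_is_equal\<close>)
  show ?thesis
  proof
    fix x y assume "x \<in> carrier (L\<lparr>carrier := S\<rparr>)" "y \<in> carrier (L\<lparr>carrier := S\<rparr>)"
    then have xy: "x \<in> S" "y \<in> S" by simp_all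
    then have xyL: "x \<in> carrier L" "y \<in> carrier L" using S by blast+
    obtain s where s: "least L s (Upper L {x, y})"
      using sup_of_two_exists[OF xyL] by blast
    obtain t where t: "greatest L t (Lower L {x, y})"
      using inf_of_two_exists[OF xyL] by blast
    have "x \<squnion> y \<in> S" "x \<sqinter> y \<in> S"
      using assms xy by (simp_all add: sublattice_def)
    then have st: "s \<in> S" "t \<in> S"
      by (simp_all add: join_eqI[OF s] meet_eqI[OF t])
    have "Upper (L\<lparr>carrier := S\<rparr>) {x, y} = Upper L {x, y} \<inter> S"
      "Lower (L\<lparr>carrier := S\<rparr>) {x, y} = Lower L {x, y} \<inter> S"
      using xy S by (auto simp: Upper_def Lower_def)
    then have "least (L\<lparr>carrier := S\<rparr>) s (Upper (L\<lparr>carrier := S\<rparr>) {x, y})"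
      "greatest (L\<lparr>carrier := S\<rparr>) t (Lower (L\<lparr>carrier := S\<rparr>) {x, y})"
      using s t st by (simp_all add: least_def greatest_def)
    then show "\<exists>s. least (L\<lparr>carrier := S\<rparr>) s (Upper (L\<lparr>carrier := S\<rparr>) {x, y})"
      "\<exists>t. greatest (L\<lparr>carrier := S\<rparr>) t (Lower (L\<lparr>carrier := S\<rparr>) {x, y})"
      by blast+
  qed
qed

theorem corollary4p13:
  fixes K :: "('k, 'r) ring_scheme" and \<Lambda> :: "('k, 'a, 's) module_scheme" and d :: nat
  assumes "algebraically_closed K"
    and "fin_dim_algebra K \<Lambda>"
    and "d \<ge> 2"
  shows "lattice (cotors \<Lambda> d) \<and>
         sublattice (cotors \<Lambda> d) (hereditary_cotors \<Lambda> d) \<and>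
         lattice ((cotors \<Lambda> d)\<lparr>carrier := hereditary_cotors \<Lambda> d\<rparr>)"
  by (intro conjI lattice.lattice_sublattice lattice_cotors sublattice_hereditary_cotors)

end
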